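(* Let $\mathbb{F}$ be an algebraically closed field of characteristic different from $2,3$, and let $\mathcal{T}_4$ be the variety of $4$-dimensional nilpotent Lie triple system structures on $\mathbb{V}=\mathbb{F}^4$. Then $\mathcal{T}_4$ has exactly two irreducible components: the closure $\overline{O(\mathcal{T}_{4,7})}$ of the orbit of $\mathcal{T}_{4,7}$, and the closure $\overline{\bigcup_{\lambda\in\mathbb{F}}O(\mathcal{T}_{4,6}^{\lambda})}$ of the union of the orbits of the family $\mathcal{T}_{4,6}^{\lambda}$. In particular $\mathcal{T}_{4,7}$ is rigid, and $\dim O(\mathcal{T}_{4,7})=11$.
   Context: A Lie triple system is a finite-dimensional vector space with a trilinear map $[\cdot,\cdot,\cdot]$ satisfying (A1) $[x,y,z]+[y,x,z]=0$; (A2) $[x,y,z]+[y,z,x]+[z,x,y]=0$; (A3) $[u,v,[x,y,z]]=[[u,v,x],y,z]+[x,[u,v,y],z]+[x,y,[u,v,z]]$; it is nilpotent if $\mathcal{T}^{(m)}=0$ for some $m$, where $\mathcal{T}^{(0)}=\mathcal{T}$, $\mathcal{T}^{(n+1)}=[\mathcal{T}^{(n)},\mathcal{T},\mathcal{T}]$. Fixing a basis of $\mathbb{V}$, a trilinear map $\mu:\mathbb{V}^3\to\mathbb{V}$ is identified with its structure constants in $\mathbb{F}^{n^4}$; $\mathcal{T}_n$ is the Zariski-closed subset of those $\mu$ defining nilpotent Lie triple systems. $\mathrm{GL}(\mathbb{V})$ acts by $(g*\mu)(x,y,z)=g\mu(g^{-1}x,g^{-1}y,g^{-1}z)$, and $O(\mu)$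 denotes the orbit; closures are in the Zariski topology. A structure is rigid if its orbit is open (equivalently its orbit closure is an irreducible component). With basis $e_1,\dots,e_4$ (products not listed and not obtained from listed ones by (A1) are zero): $\mathcal{T}_{4,7}$: $[e_1,e_2,e_1]=e_3$, $[e_1,e_2,e_3]=e_4$, $[e_1,e_3,e_2]=e_4$; $\mathcal{T}_{4,6}^{\lambda}$ ($\lambda\in\mathbb{F}$): $[e_1,e_2,e_3]=-(\lambda+1)e_4$, $[e_2,e_3,e_1]=\lambda e_4$, $[e_3,e_1,e_2]=e_4$. *)

theory Defs
  imports "HOL-Analysis.Analysis" "HOL-Computational_Algebra.Polynomial"
    "HOL-Library.Numeral_Type" "HOL-Library.Extended_Nat"
begin

inductive_set polyfun :: "(('i \<Rightarrow> 'a::comm_ring_1) \<Rightarrow> 'a) set" where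
  pf_const: "(\<lambda>x. c) \<in> polyfun"
| pf_var: "(\<lambda>x. x i) \<in> polyfun"
| pf_add: "p \<in> polyfun \<Longrightarrow> q \<in> polyfun \<Longrightarrow> (\<lambda>x. p x + q x) \<in> polyfun"
| pf_mult: "p \<in> polyfun \<Longrightarrow> q \<in> polyfun \<Longrightarrow> (\<lambda>x. p x * q x) \<in> polyfun"

definition zariski_closed :: "('i \<Rightarrow> 'a::comm_ring_1) set \<Rightarrow> bool" where
  "zariski_closed A \<longleftrightarrow> (\<exists>P \<subseteq> polyfun. A = {x. \<forall>p\<in>P. p x = 0})"

definition zariski_closure :: "('i \<Rightarrow> 'a::comm_ring_1) set \<Rightarrow> ('i \<Rightarrow> 'a) set" where
  "zariski_closure A = \<Inter>{C. zariski_closed C \<and> A \<subseteq> C}"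

definition rel_closed :: "('i \<Rightarrow> 'a::comm_ring_1) set \<Rightarrow> ('i \<Rightarrow> 'a) set \<Rightarrow> bool" where
  "rel_closed X A \<longleftrightarrow> (\<exists>C. zariski_closed C \<and> A = X \<inter> C)"

definition rel_open :: "('i \<Rightarrow> 'a::comm_ring_1) set \<Rightarrow> ('i \<Rightarrow> 'a) set \<Rightarrow> bool" where
  "rel_open X U \<longleftrightarrow> (\<exists>C. zariski_closed C \<and> U = X - C)"

definition zariski_irreducible :: "('i \<Rightarrow> 'a::comm_ring_1) set \<Rightarrow> bool" where
  "zariski_irreducible Z \<longleftrightarrow> Z \<noteq> {} \<and>
     (\<forall>C D. zariski_closed C \<and> zariski_closed D \<and> Z \<subseteq> C \<union> D \<longrightarrow> Z \<subseteq> C \<or> Z \<subseteq> D)"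

definition irreducible_component :: "('i \<Rightarrow> 'a::comm_ring_1) set \<Rightarrow> ('i \<Rightarrow> 'a) set \<Rightarrow> bool" where
  "irreducible_component X Z \<longleftrightarrow> Z \<subseteq> X \<and> zariski_irreducible Z \<and>
     (\<forall>W. W \<subseteq> X \<and> zariski_irreducible W \<and> Z \<subseteq> W \<longrightarrow> W = Z)"

definition zariski_dim :: "('i \<Rightarrow> 'a::comm_ring_1) set \<Rightarrow> enat" where
  "zariski_dim X = Sup {enat k | k. \<exists>Z :: nat \<Rightarrow> ('i \<Rightarrow> 'a) set.
      (\<forall>i\<le>k. zariski_irreducible (Z i) \<and> rel_closed X (Z i)) \<and> (\<forall>i<k. Z i \<subset> Z (Suc i))}"

text \<open>mu (i,j,k,l) is the coefficient of e_l in [e_i,e_j,e_k].\<close>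
type_synonym ('a, 'n) struct = "'n \<times> 'n \<times> 'n \<times> 'n \<Rightarrow> 'a"

definition bracket :: "('a::comm_ring_1, 'n::finite) struct \<Rightarrow> 'a^'n \<Rightarrow> 'a^'n \<Rightarrow> 'a^'n \<Rightarrow> 'a^'n" where
  "bracket mu x y z = (\<chi> l. \<Sum>i\<in>UNIV. \<Sum>j\<in>UNIV. \<Sum>k\<in>UNIV. x$i * y$j * z$k * mu (i,j,k,l))"

definition is_LTS :: "('a::comm_ring_1, 'n::finite) struct \<Rightarrow> bool" where
  "is_LTS mu \<longleftrightarrow>
     (\<forall>x y z. bracket mu x y z + bracket mu y x z = 0) \<and>
     (\<forall>x y z. bracket mu x y z + bracket mu y z x + bracket mu z x y = 0) \<and>
     (\<forall>u v x y z. bracket mu u v (bracket mu x y z) =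
         bracket mu (bracket mu u v x) y z + bracket mu x (bracket mu u v y) z
         + bracket mu x y (bracket mu u v z))"

fun lts_series :: "('a::field, 'n::finite) struct \<Rightarrow> nat \<Rightarrow> ('a^'n) set" where
  "lts_series mu 0 = UNIV"
| "lts_series mu (Suc m) = vec.span {bracket mu a b c | a b c. a \<in> lts_series mu m}"

definition nilpotent_LTS :: "('a::field, 'n::finite) struct \<Rightarrow> bool" where
  "nilpotent_LTS mu \<longleftrightarrow> is_LTS mu \<and> (\<exists>m. lts_series mu m = {0})"

definition LTS_variety :: "('a::field, 'n::finite) struct set" where
  "LTS_variety = {mu. nilpotent_LTS mu}"

definition gl_act :: "'a::field^'n^'n \<Rightarrow> ('a, 'n::finite) struct \<Rightarrow> ('a, 'n) struct" where
  "gl_act g mu = (\<lambda>(i,j,k,l). (g *v bracket mu (matrix_inv g *v axis i 1)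
      (matrix_inv g *v axis j 1) (matrix_inv g *v axis k 1)) $ l)"

definition orbit :: "('a::field, 'n::finite) struct \<Rightarrow> ('a, 'n) struct set" where
  "orbit mu = {gl_act g mu | g. invertible g}"

definition rigid :: "('a::field, 'n::finite) struct \<Rightarrow> bool" where
  "rigid mu \<longleftrightarrow> rel_open (LTS_variety :: ('a,'n) struct set) (orbit mu)"

section \<open>The 4-dimensional structures (e_1,...,e_4 are axis 0,1,2,3 of type 4)\<close>

definition T47 :: "('a::comm_ring_1, 4) struct" where
  "T47 = (\<lambda>t.
     if t = (0,1,0,2) then 1 else if t = (1,0,0,2) then -1
     else if t = (0,1,2,3) then 1 else if t = (1,0,2,3) then -1
     else if t = (0,2,1,3) then 1 else if t = (2,0,1,3) then -1
     else 0)"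

definition T46 :: "'a::comm_ring_1 \<Rightarrow> ('a, 4) struct" where
  "T46 lam = (\<lambda>t.
     if t = (0,1,2,3) then -(lam+1) else if t = (1,0,2,3) then lam+1
     else if t = (1,2,0,3) then lam else if t = (2,1,0,3) then -lam
     else if t = (2,0,1,3) then 1 else if t = (0,2,1,3) then -1
     else 0)"

end

theory Submission
  imports Defs
begin

text \<open>A nilpotent Lie triple system \<open>T\<close> of dimension 4 has a basis adapted to a complete flag. If
  \<open>dim [T,T,T] = 2\<close>, the derivation identity leaves a five-parameter family in a fixed flag, whose
  generic member is conjugate to \<open>T47\<close>. Otherwise \<open>[x,y,z] = (x \<times> y) \<cdot> A z\<close> on the quotient by a
  central line, for a traceless 3 by 3 matrix \<open>A\<close>; over an algebraically closed field \<open>A\<close> is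
  triangularisable, a generic triangular \<open>A\<close> is diagonalisable, and the diagonal case is \<open>T46\<close>. The
  two closures are told apart by the identities \<open>[x,y,[x,y,z]] = 0\<close>, which cuts out the complement
  of the orbit of \<open>T47\<close>, and \<open>det A = 0\<close>.

  For the dimension, a chain of \<open>k + 1\<close> irreducible closed sets produces \<open>k\<close> algebraically
  independent polynomials, whereas a set that is generically parametrised by \<open>n\<close> variables carries at
  most \<open>n\<close> of them. The orbit of \<open>T47\<close> is parametrised by 6 coordinates of a flag and the 5 structure
  constants; freeing these one at a time gives a chain of the maximal length.\<close>


section \<open>Zariski topology on affine space\<close>

text \<open>Statements about closures are reduced to test polynomials: a polynomial that vanishes
  off a hypersurface of affine space vanishes identically, so membership in a closure need only be
  checked at generic parameters. Two obstacles shape the rest. Matrix inversion is not polynomial,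
  so an orbit does not come as the image of a polynomial map. With the adjugate in place of the
  inverse the action becomes polynomial up to the scalar \<open>det g ^ 3\<close>, which is harmless
  because \<open>T47\<close> and each \<open>T46 lam\<close> have their nonzero multiples in their
  own orbits. Nilpotency is an existential condition on the length of the series, so it is not
  visibly closed; the two closures are kept inside the variety by the closed conditions
  \<open>is_LTS\<close> and \<open>[[[a,b,c],d,e],x,y] = 0\<close>, which hold on all the orbits
  concerned. Roots are extracted twice in the reduction to normal form: of a characteristic
  polynomial, and of one quadratic. Characteristic different from 2 gives \<open>[x,x,z] = 0\<close>
  and the completion of a square in the normal form of \<open>T47\<close>.\<close>

lemma polyfun_sum: "(\<And>a. a \<in> A \<Longrightarrow> f a \<in> polyfun) \<Longrightarrow> (\<lambda>x. \<Sum>a\<in>A. f a x) \<in> polyfun"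
  by (induction A rule: infinite_finite_induct) (auto intro: polyfun.intros)

lemma polyfun_prod: "(\<And>a. a \<in> A \<Longrightarrow> f a \<in> polyfun) \<Longrightarrow> (\<lambda>x. \<Prod>a\<in>A. f a x) \<in> polyfun"
  by (induction A rule: infinite_finite_induct) (auto intro: polyfun.intros)

lemma polyfun_uminus: "f \<in> polyfun \<Longrightarrow> (\<lambda>x. - f x) \<in> polyfun"
  using pf_mult[OF pf_const[of "-1"], of f] by simp

lemma polyfun_diff: "f \<in> polyfun \<Longrightarrow> g \<in> polyfun \<Longrightarrow> (\<lambda>x. f x - g x) \<in> polyfun"
  using pf_add[OF _ polyfun_uminus[of g], of f] by simp

lemma polyfun_power: "f \<in> polyfun \<Longrightarrow> (\<lambda>x. f x ^ n) \<in> polyfun"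
  by (induction n) (auto intro: polyfun.intros)

lemmas polyfun_intros = polyfun.intros polyfun_sum polyfun_prod polyfun_uminus polyfun_diff polyfun_power

lemma polyfun_compose:
  assumes "p \<in> polyfun" and "\<And>i. (\<lambda>x. f x i) \<in> polyfun"
  shows "(\<lambda>x. p (f x)) \<in> polyfun"
  using assms(1)
proof (induction p)
  case (pf_const c)
  show ?case by (rule polyfun.pf_const)
next
  case (pf_var i)
  show ?case by (rule assms(2))
next
  case (pf_add p q)
  then show ?case by (intro polyfun.pf_add)
next
  case (pf_mult p q)
  then show ?case by (intro polyfun.pf_mult)
qed

lemma zariski_closed_polyfun: "p \<in> polyfun \<Longrightarrow> zariski_closed {x. p x = 0}"
  unfolding zariski_closed_def by (rule exI[of _ "{p}"]) auto

text \<open>Taking every polynomial that vanishes on at least one member avoids choosing equations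
  for each member.\<close>

lemma zariski_closed_Inter:
  assumes "\<And>C. C \<in> \<C> \<Longrightarrow> zariski_closed C"
  shows "zariski_closed (\<Inter>\<C>)"
proof -
  define P where "P = {p \<in> polyfun. \<exists>C\<in>\<C>. \<forall>x\<in>C. p x = 0}"
  have "x \<in> C" if C: "C \<in> \<C>" and x: "\<forall>p\<in>P. p x = 0" for x C
  proof -
    obtain Q where Q: "Q \<subseteq> polyfun" "C = {x. \<forall>p\<in>Q. p x = 0}"
      using assms[OF C] unfolding zariski_closed_def by blast
    have "p x = 0" if "p \<in> Q" for p
    proof -
      have "\<forall>y\<in>C. p y = 0" using that by (simp add: Q(2))
      then have "p \<in> P" using C Q(1) that unfolding P_def by auto
      then show ?thesis using x by auto
    qed
    then show ?thesis by (subst Q(2)) auto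
  qed
  moreover have "p x = 0" if "x \<in> \<Inter>\<C>" "p \<in> P" for x p
    using that unfolding P_def by blast
  ultimately have "\<Inter>\<C> = {x. \<forall>p\<in>P. p x = 0}" by blast
  moreover have "P \<subseteq> polyfun" unfolding P_def by blast
  ultimately show ?thesis unfolding zariski_closed_def by blast
qed

lemma zariski_closed_Collect_all:
  assumes "\<And>a. zariski_closed {x. P a x}"
  shows "zariski_closed {x. \<forall>a. P a x}"
proof -
  have "{x. \<forall>a. P a x} = \<Inter>(range (\<lambda>a. {x. P a x}))" by auto
  then show ?thesis using zariski_closed_Inter[of "range (\<lambda>a. {x. P a x})"] assms by auto
qed

lemma zariski_closed_Collect_conj:
  assumes "zariski_closed {x. P x}" and "zariski_closed {x. Q x}"
  shows "zariski_closed {x. P x \<and> Q x}"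
proof -
  have "{x. P x \<and> Q x} = \<Inter>{{x. P x}, {x. Q x}}" by auto
  then show ?thesis using zariski_closed_Inter[of "{{x. P x}, {x. Q x}}"] assms by auto
qed

lemma zariski_closed_closure: "zariski_closed (zariski_closure A)"
  unfolding zariski_closure_def by (rule zariski_closed_Inter) auto

lemma zariski_closure_superset: "A \<subseteq> zariski_closure A"
  unfolding zariski_closure_def by auto

lemma zariski_closure_minimal: "A \<subseteq> C \<Longrightarrow> zariski_closed C \<Longrightarrow> zariski_closure A \<subseteq> C"
  unfolding zariski_closure_def by auto

lemma zariski_closureI:
  assumes "\<And>p. p \<in> polyfun \<Longrightarrow> (\<And>a. a \<in> A \<Longrightarrow> p a = 0) \<Longrightarrow> p x = 0"
  shows "x \<in> zariski_closure A"
  unfolding zariski_closure_def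
proof clarify
  fix C assume C: "zariski_closed C" "A \<subseteq> C"
  then obtain P where P: "P \<subseteq> polyfun" "C = {x. \<forall>p\<in>P. p x = 0}"
    unfolding zariski_closed_def by blast
  then show "x \<in> C" using assms C(2) by blast
qed

lemma zariski_closureD:
  assumes "x \<in> zariski_closure A" "p \<in> polyfun" "\<And>a. a \<in> A \<Longrightarrow> p a = 0"
  shows "p x = 0"
  using zariski_closure_minimal[OF _ zariski_closed_polyfun[OF assms(2)], of A] assms by blast

lemma zariski_closure_image:
  assumes f: "\<And>i. (\<lambda>x. f x i) \<in> polyfun" and fA: "f ` A \<subseteq> zariski_closure B"
    and x: "x \<in> zariski_closure A"
  shows "f x \<in> zariski_closure B"
proof (rule zariski_closureI)
  fix p assume p: "p \<in> polyfun" "\<And>b. b \<in> B \<Longrightarrow> p b = 0"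
  have "p (f a) = 0" if "a \<in> A" for a
    by (rule zariski_closureD[OF _ p]) (use fA that in auto)
  then show "p (f x) = 0"
    by (rule zariski_closureD[OF x polyfun_compose[OF p(1) f]])
qed

text \<open>Irreducibility is primality of the vanishing ideal: a point outside a closed set is
  witnessed by a single polynomial, and the product of witnesses for \<open>C\<close> and
  \<open>D\<close> vanishes on any set covered by \<open>C \<union> D\<close>.\<close>

lemma zariski_irreducible_iff:
  fixes Z :: "('i \<Rightarrow> 'a::idom) set"
  shows "zariski_irreducible Z \<longleftrightarrow> Z \<noteq> {} \<and>
    (\<forall>p\<in>polyfun. \<forall>q\<in>polyfun. (\<forall>z\<in>Z. p z * q z = 0) \<longrightarrow> (\<forall>z\<in>Z. p z = 0) \<or> (\<forall>z\<in>Z. q z = 0))"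
    (is "_ \<longleftrightarrow> _ \<and> ?prime")
proof (cases "Z = {}")
  case False
  have ?prime if irr: "zariski_irreducible Z"
  proof (intro ballI impI)
    fix p q :: "('i \<Rightarrow> 'a) \<Rightarrow> 'a"
    assume pq: "p \<in> polyfun" "q \<in> polyfun" and 0: "\<forall>z\<in>Z. p z * q z = 0"
    have "Z \<subseteq> {z. p z = 0} \<union> {z. q z = 0}" using 0 by auto
    then have "Z \<subseteq> {z. p z = 0} \<or> Z \<subseteq> {z. q z = 0}"
      using irr pq[THEN zariski_closed_polyfun] unfolding zariski_irreducible_def by simp
    then show "(\<forall>z\<in>Z. p z = 0) \<or> (\<forall>z\<in>Z. q z = 0)" by auto
  qed
  moreover have "zariski_irreducible Z" if prime: ?prime
    unfolding zariski_irreducible_def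
  proof (intro conjI allI impI)
    fix C D assume CD: "zariski_closed C \<and> zariski_closed D \<and> Z \<subseteq> C \<union> D"
    then obtain P Q where P: "P \<subseteq> polyfun" "C = {x. \<forall>p\<in>P. p x = 0}"
      and Q: "Q \<subseteq> polyfun" "D = {x. \<forall>p\<in>Q. p x = 0}"
      unfolding zariski_closed_def by blast
    show "Z \<subseteq> C \<or> Z \<subseteq> D"
    proof (rule ccontr)
      assume "\<not> (Z \<subseteq> C \<or> Z \<subseteq> D)"
      then obtain x y where xy: "x \<in> Z" "x \<notin> C" "y \<in> Z" "y \<notin> D" by blast
      obtain p where p: "p \<in> P" "p x \<noteq> 0" using xy(2) by (auto simp: P(2))
      obtain q where q: "q \<in> Q" "q y \<noteq> 0" using xy(4) by (auto simp: Q(2))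
      have "p z * q z = 0" if "z \<in> Z" for z
      proof -
        have "z \<in> C \<or> z \<in> D" using CD that by blast
        then show ?thesis using p(1) q(1) by (auto simp: P(2) Q(2))
      qed
      then have "(\<forall>z\<in>Z. p z = 0) \<or> (\<forall>z\<in>Z. q z = 0)"
        using prime p(1) q(1) P(1) Q(1) by blast
      then show False using xy p q by blast
    qed
  qed (use False in auto)
  ultimately show ?thesis using False by blast
qed (auto simp: zariski_irreducible_def)

lemma zariski_irreducible_prime:
  fixes Z :: "('i \<Rightarrow> 'a::idom) set"
  assumes "zariski_irreducible Z" "p \<in> polyfun" "q \<in> polyfun" "\<And>z. z \<in> Z \<Longrightarrow> p z * q z = 0"
  shows "(\<forall>z\<in>Z. p z = 0) \<or> (\<forall>z\<in>Z. q z = 0)"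
  using assms unfolding zariski_irreducible_iff by blast

lemma zariski_irreducibleD:
  fixes Z :: "('i \<Rightarrow> 'a::idom) set"
  assumes "zariski_irreducible Z" "p \<in> polyfun" "q \<in> polyfun" "\<And>z. z \<in> Z \<Longrightarrow> p z * q z = 0"
    and "x \<in> Z" "p x \<noteq> 0" "y \<in> Z"
  shows "q y = 0"
  using zariski_irreducible_prime[OF assms(1-4)] assms(5-7) by blast

text \<open>A polynomial vanishing on \<open>S\<close> vanishes on its closure, so \<open>S\<close>
  and \<open>Z\<close> have the same vanishing ideal. It serves for full closures and for closures
  cut with an orbit.\<close>

lemma zariski_irreducible_between:
  fixes S :: "('i \<Rightarrow> 'a::idom) set"
  assumes S: "zariski_irreducible S" and Z: "S \<subseteq> Z" "Z \<subseteq> zariski_closure S"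
  shows "zariski_irreducible Z"
  unfolding zariski_irreducible_iff
proof (intro conjI ballI impI)
  show "Z \<noteq> {}" using S Z unfolding zariski_irreducible_def by auto
  fix p q :: "('i \<Rightarrow> 'a) \<Rightarrow> 'a"
  assume pq: "p \<in> polyfun" "q \<in> polyfun" and "\<forall>z\<in>Z. p z * q z = 0"
  then have "(\<forall>z\<in>S. p z = 0) \<or> (\<forall>z\<in>S. q z = 0)"
    using S Z(1) unfolding zariski_irreducible_iff by blast
  then show "(\<forall>z\<in>Z. p z = 0) \<or> (\<forall>z\<in>Z. q z = 0)"
    using pq Z(2) zariski_closureD by blast
qed

lemma zariski_irreducible_image:
  fixes Z :: "('i \<Rightarrow> 'a::idom) set" and f :: "('i \<Rightarrow> 'a) \<Rightarrow> 'j \<Rightarrow> 'a"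
  assumes Z: "zariski_irreducible Z" and f: "\<And>j. (\<lambda>x. f x j) \<in> polyfun"
  shows "zariski_irreducible (f ` Z)"
  unfolding zariski_irreducible_iff
proof (intro conjI ballI impI)
  show "f ` Z \<noteq> {}" using Z unfolding zariski_irreducible_def by auto
  fix p q :: "('j \<Rightarrow> 'a) \<Rightarrow> 'a"
  assume pq: "p \<in> polyfun" "q \<in> polyfun" and 0: "\<forall>z\<in>f ` Z. p z * q z = 0"
  have "(\<lambda>x. p (f x)) \<in> polyfun" "(\<lambda>x. q (f x)) \<in> polyfun"
    using pq f by (auto intro: polyfun_compose)
  moreover have "\<forall>z\<in>Z. p (f z) * q (f z) = 0" using 0 by auto
  ultimately have "(\<forall>z\<in>Z. p (f z) = 0) \<or> (\<forall>z\<in>Z. q (f z) = 0)"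
    using zariski_irreducible_prime[OF Z, of "\<lambda>x. p (f x)" "\<lambda>x. q (f x)"] by blast
  then show "(\<forall>z\<in>f ` Z. p z = 0) \<or> (\<forall>z\<in>f ` Z. q z = 0)" by auto
qed

section \<open>Irreducibility of affine space and density of principal open sets\<close>

lemma polyfun_on_line:
  fixes p :: "('i \<Rightarrow> 'a::comm_ring_1) \<Rightarrow> 'a"
  assumes "p \<in> polyfun"
  shows "\<exists>P. \<forall>t. poly P t = p (\<lambda>i. x i + t * (y i - x i))"
  using assms
proof (induction p)
  case (pf_const c)
  show ?case by (rule exI[of _ "[:c:]"]) simp
next
  case (pf_var i)
  show ?case by (rule exI[of _ "[:x i, y i - x i:]"]) simp
next
  case (pf_add p q)
  then show ?case by (metis poly_add)
next
  case (pf_mult p q)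
  then show ?case by (metis poly_mult)
qed

text \<open>Over a finite field, one plus the product of all \<open>X - a\<close> has positive
  degree and no root.\<close>

lemma infinite_UNIV_alg_closed: "infinite (UNIV :: 'a::alg_closed_field set)"
proof
  assume fin: "finite (UNIV :: 'a set)"
  define p :: "'a poly" where "p = (\<Prod>a\<in>UNIV. [:-a, 1:]) + 1"
  have "degree (\<Prod>a\<in>(UNIV::'a set). [:-a, 1:]) = card (UNIV :: 'a set)"
    by (subst degree_prod_eq_sum_degree) auto
  moreover have "card (UNIV :: 'a set) > 0" using fin by (simp add: card_gt_0_iff)
  ultimately have "degree p > 0"
    unfolding p_def by (subst degree_add_eq_left) auto
  then obtain x where "poly p x = 0" using alg_closed_imp_poly_has_root by blast
  moreover have "poly p x = 1"
    using fin by (auto simp: p_def poly_prod intro: prod_zero)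
  ultimately show False by simp
qed

text \<open>On the line through a point with \<open>p \<noteq> 0\<close> and a point with
  \<open>q \<noteq> 0\<close> both become nonzero polynomials in one variable, and their product has
  only finitely many roots.\<close>

lemma zariski_irreducible_UNIV:
  assumes "infinite (UNIV :: 'a::field set)"
  shows "zariski_irreducible (UNIV :: ('i \<Rightarrow> 'a) set)"
  unfolding zariski_irreducible_iff
proof (intro conjI ballI impI)
  fix p q :: "('i \<Rightarrow> 'a) \<Rightarrow> 'a"
  assume pq: "p \<in> polyfun" "q \<in> polyfun" and 0: "\<forall>z\<in>UNIV. p z * q z = 0"
  show "(\<forall>z\<in>UNIV. p z = 0) \<or> (\<forall>z\<in>UNIV. q z = 0)"
  proof (rule ccontr)
    assume "\<not> ((\<forall>z\<in>UNIV. p z = 0) \<or> (\<forall>z\<in>UNIV. q z = 0))"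
    then obtain x y where xy: "p x \<noteq> 0" "q y \<noteq> 0" by auto
    obtain P where P: "\<And>t. poly P t = p (\<lambda>i. x i + t * (y i - x i))"
      using polyfun_on_line[OF pq(1), of x y] by auto
    obtain Q where Q: "\<And>t. poly Q t = q (\<lambda>i. x i + t * (y i - x i))"
      using polyfun_on_line[OF pq(2), of x y] by auto
    have "poly P 0 \<noteq> 0" "poly Q 1 \<noteq> 0" using xy by (simp_all add: P Q)
    then have "P * Q \<noteq> 0" by auto
    then have "finite {t. poly (P * Q) t = 0}" by (rule poly_roots_finite)
    moreover have "{t. poly (P * Q) t = 0} = UNIV" using 0 by (simp add: P Q)
    ultimately show False using assms by (simp del: poly_mult)
  qed
qed auto

text \<open>Density of a nonempty principal open set, in the form used for arguments by generic
  parameters: \<open>p * q\<close> vanishes everywhere and \<open>p\<close> does not.\<close>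

lemma polyfun_eq_0_if_mult:
  fixes p q :: "('i \<Rightarrow> 'a::field) \<Rightarrow> 'a"
  assumes "infinite (UNIV :: 'a set)" "p \<in> polyfun" "q \<in> polyfun" "p x \<noteq> 0"
    and "\<And>z. p z \<noteq> 0 \<Longrightarrow> q z = 0"
  shows "q y = 0"
  by (rule zariski_irreducibleD[OF zariski_irreducible_UNIV[OF assms(1)] assms(2,3), of x])
     (use assms in auto)

lemma zariski_irreducible_principal_open:
  fixes p :: "('i \<Rightarrow> 'a::field) \<Rightarrow> 'a"
  assumes inf: "infinite (UNIV :: 'a set)" and p: "p \<in> polyfun" "p x \<noteq> 0"
  shows "zariski_irreducible {z. p z \<noteq> 0}"
  unfolding zariski_irreducible_iff
proof (intro conjI ballI impI)
  show "{z. p z \<noteq> 0} \<noteq> {}" using p by auto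
  fix f g :: "('i \<Rightarrow> 'a) \<Rightarrow> 'a"
  assume fg: "f \<in> polyfun" "g \<in> polyfun" and 0: "\<forall>z\<in>{z. p z \<noteq> 0}. f z * g z = 0"
  have "f z * g z = 0" for z
    using polyfun_eq_0_if_mult[OF inf p(1) pf_mult[OF fg] p(2), of z] 0 by auto
  then have "(\<forall>z. f z = 0) \<or> (\<forall>z. g z = 0)"
    using zariski_irreducible_prime[OF zariski_irreducible_UNIV[OF inf] fg] by blast
  then show "(\<forall>z\<in>{z. p z \<noteq> 0}. f z = 0) \<or> (\<forall>z\<in>{z. p z \<noteq> 0}. g z = 0)" by blast
qed

lemma irreducible_components_of_union:
  assumes "zariski_closed A" "zariski_closed B" "zariski_irreducible A" "zariski_irreducible B"
    and X: "X = A \<union> B" and "\<not> A \<subseteq> B" "\<not> B \<subseteq> A"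
  shows "{Z. irreducible_component X Z} = {A, B}"
proof -
  have sub: "W \<subseteq> A \<or> W \<subseteq> B" if "W \<subseteq> X" "zariski_irreducible W" for W
    using that assms(1,2) unfolding zariski_irreducible_def X by metis
  have comp: "irreducible_component X C"
    if "C \<subseteq> X" "zariski_irreducible C" and "\<And>W. W \<subseteq> X \<Longrightarrow> zariski_irreducible W \<Longrightarrow> C \<subseteq> W \<Longrightarrow> W \<subseteq> C" for C
    unfolding irreducible_component_def using that by (intro conjI allI impI equalityI) auto
  have "irreducible_component X A"
    by (rule comp) (use assms sub in auto)
  moreover have "irreducible_component X B"
    by (rule comp) (use assms sub in auto)
  moreover have "Z = A \<or> Z = B" if "irreducible_component X Z" for Z
    using that sub[of Z] assms(3,4) unfolding irreducible_component_def X by auto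
  ultimately show ?thesis by auto
qed

section \<open>Algebraic independence and dimension\<close>

definition monom_fun :: "(nat \<Rightarrow> 'x \<Rightarrow> 'a::comm_ring_1) \<Rightarrow> nat \<Rightarrow> (nat \<Rightarrow> nat) \<Rightarrow> 'x \<Rightarrow> 'a" where
  "monom_fun f k e x = (\<Prod>i<k. f i x ^ e i)"

text \<open>Exponents are padded by zero from \<open>k\<close> on, so distinct members of
  \<open>E\<close> are distinct monomials, and a nonempty \<open>E\<close> with nonzero coefficients
  encodes a nonzero polynomial.\<close>

definition alg_dependent :: "'x set \<Rightarrow> nat \<Rightarrow> (nat \<Rightarrow> 'x \<Rightarrow> 'a::comm_ring_1) \<Rightarrow> bool" where
  "alg_dependent S k f \<longleftrightarrow> (\<exists>E c. finite E \<and> E \<noteq> {} \<and> (\<forall>e\<in>E. c e \<noteq> 0) \<and>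
     (\<forall>e\<in>E. \<forall>i\<ge>k. e i = 0) \<and> (\<forall>x\<in>S. (\<Sum>e\<in>E. c e * monom_fun f k e x) = 0))"

lemma monom_fun_polyfun:
  assumes "\<And>i. i < k \<Longrightarrow> f i \<in> polyfun"
  shows "monom_fun f k e \<in> polyfun"
proof -
  have "(\<lambda>x. f i x ^ e i) \<in> polyfun" if "i < k" for i
    using polyfun_power[OF assms[OF that]] .
  then have "(\<lambda>x. \<Prod>i<k. f i x ^ e i) \<in> polyfun"
    using polyfun_prod[of "{..<k}" "\<lambda>i x. f i x ^ e i"] by simp
  then show ?thesis by (simp add: monom_fun_def[abs_def])
qed

text \<open>If \<open>h\<close> vanishes on the smaller set, a relation among \<open>f\<^sub>0, \<dots>, f\<^sub>k\<^sub>-\<^sub>1, h\<close> on the larger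
  irreducible set can be divided by the lowest power of \<open>h\<close> and then restricted to the smaller set.\<close>
lemma alg_dependent_restrict:
  fixes f :: "nat \<Rightarrow> ('i \<Rightarrow> 'a::idom) \<Rightarrow> 'a"
  assumes Z': "zariski_irreducible Z'" and "Z \<subseteq> Z'" and f: "\<And>i. i \<le> k \<Longrightarrow> f i \<in> polyfun"
    and h0: "\<And>z. z \<in> Z \<Longrightarrow> f k z = 0" and h1: "w \<in> Z'" "f k w \<noteq> 0"
    and dep: "alg_dependent Z' (Suc k) f"
  shows "alg_dependent Z k f"
proof -
  obtain E c where E: "finite E" "E \<noteq> {}" and c: "\<And>e. e \<in> E \<Longrightarrow> c e \<noteq> 0"
    and supp: "\<And>e i. e \<in> E \<Longrightarrow> i \<ge> Suc k \<Longrightarrow> e i = 0"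
    and rel: "\<And>x. x \<in> Z' \<Longrightarrow> (\<Sum>e\<in>E. c e * monom_fun f (Suc k) e x) = 0"
    using dep unfolding alg_dependent_def by metis
  define m where "m = Min ((\<lambda>e. e k) ` E)"
  have m_le: "m \<le> e k" if "e \<in> E" for e using that E unfolding m_def by auto
  have "m \<in> (\<lambda>e. e k) ` E" using E unfolding m_def by (intro Min_in) auto
  then obtain e0 where e0: "e0 \<in> E" "e0 k = m" by auto
  define g where "g x = (\<Sum>e\<in>E. c e * (monom_fun f k e x * f k x ^ (e k - m)))" for x
  have g: "g \<in> polyfun" unfolding g_def[abs_def]
    by (intro polyfun_sum pf_mult pf_const monom_fun_polyfun polyfun_power) (use f in auto)
  have split: "monom_fun f (Suc k) e x = f k x ^ m * (monom_fun f k e x * f k x ^ (e k - m))"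
    if "e \<in> E" for e x
    using m_le[OF that] by (simp add: monom_fun_def power_add[symmetric] mult_ac)
  have "f k x ^ m * g x = 0" if "x \<in> Z'" for x
  proof -
    have "f k x ^ m * g x = (\<Sum>e\<in>E. c e * monom_fun f (Suc k) e x)"
      unfolding g_def sum_distrib_left by (rule sum.cong) (auto simp: split)
    then show ?thesis using rel[OF that] by simp
  qed
  then have g0: "g x = 0" if "x \<in> Z'" for x
    using zariski_irreducibleD[OF Z' polyfun_power[OF f[of k], of m] g _ h1(1) _ that] h1(2) by auto
  define E' where "E' = {e \<in> E. e k = m}"
  \<comment> \<open>All members of \<open>E'\<close> have the same exponent \<open>m\<close> at
    \<open>k\<close>, so erasing it keeps them distinct.\<close>
  define r where "r e = e(k := 0)" for e :: "nat \<Rightarrow> nat"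
  have inj: "inj_on r E'"
    unfolding inj_on_def E'_def r_def by (auto simp: fun_eq_iff) (metis)
  have mr: "monom_fun f k (r e) x = monom_fun f k e x" for e x
    unfolding monom_fun_def r_def by (intro prod.cong) auto
  have "(\<Sum>e\<in>r ` E'. c (inv_into E' r e) * monom_fun f k e x) = 0" if x: "x \<in> Z" for x
  proof -
    have "(\<Sum>e\<in>r ` E'. c (inv_into E' r e) * monom_fun f k e x) = (\<Sum>e\<in>E'. c e * monom_fun f k e x)"
      by (subst sum.reindex[OF inj]) (auto intro!: sum.cong simp: inj mr)
    also have "\<dots> = (\<Sum>e\<in>E. if e k = m then c e * monom_fun f k e x else 0)"
      unfolding E'_def using E by (simp add: sum.inter_filter)
    \<comment> \<open>On \<open>Z\<close> the factor \<open>f k x ^ (e k - m)\<close> is a power of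
      zero, equal to 1 exactly for the exponents kept in \<open>E'\<close>.\<close>
    also have "\<dots> = g x"
      unfolding g_def
      by (rule sum.cong) (use m_le h0[OF x] in \<open>auto simp: power_0_left dest!: le_antisym\<close>)
    finally show ?thesis using g0 x assms(2) by auto
  qed
  moreover have "finite (r ` E')" "r ` E' \<noteq> {}" using E e0 unfolding E'_def by auto
  moreover have "\<forall>e\<in>r ` E'. c (inv_into E' r e) \<noteq> 0"
    using c inj by (auto simp: E'_def)
  moreover have "\<forall>e\<in>r ` E'. \<forall>i\<ge>k. e i = 0"
    using supp by (auto simp: E'_def r_def)
  ultimately show ?thesis unfolding alg_dependent_def
    by (intro exI[of _ "r ` E'"] exI[of _ "\<lambda>e. c (inv_into E' r e)"] conjI) auto
qed

text \<open>Each strict inclusion contributes one polynomial \<open>h\<close> that vanishes on the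
  smaller set but not on the larger; a relation involving \<open>h\<close> would restrict to a
  relation among the earlier polynomials. At length zero a relation would be a nonzero constant
  vanishing at a point.\<close>

lemma chain_algebraically_independent:
  fixes X :: "('i \<Rightarrow> 'a::idom) set"
  assumes Z: "\<And>i. i \<le> k \<Longrightarrow> zariski_irreducible (Z i) \<and> rel_closed X (Z i)"
    and strict: "\<And>i. i < k \<Longrightarrow> Z i \<subset> Z (Suc i)"
  shows "\<exists>f. (\<forall>i<k. f i \<in> polyfun) \<and> \<not> alg_dependent (Z k) k f"
  using assms
proof (induction k)
  case 0
  then have "Z 0 \<noteq> {}" by (auto simp: zariski_irreducible_def)
  then obtain z where z: "z \<in> Z 0" by auto
  have "\<not> alg_dependent (Z 0) 0 f" for f :: "nat \<Rightarrow> ('i \<Rightarrow> 'a) \<Rightarrow> 'a"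
  proof
    assume "alg_dependent (Z 0) 0 f"
    then obtain E c where E: "finite E" "E \<noteq> {}" and c: "\<forall>e\<in>E. c e \<noteq> 0"
      and supp: "\<forall>e\<in>E. \<forall>i\<ge>0. e i = 0"
      and rel: "\<forall>x\<in>Z 0. (\<Sum>e\<in>E. c e * monom_fun f 0 e x) = 0"
      unfolding alg_dependent_def by (elim exE conjE) (rule that)
    have "e = (\<lambda>_. 0)" if "e \<in> E" for e using supp that by (auto simp: fun_eq_iff)
    then have "E = {\<lambda>_. 0}" using E(2) by blast
    then show False using rel c z by (simp add: monom_fun_def)
  qed
  then show ?case by auto
next
  case (Suc k)
  then obtain f where f: "\<And>i. i < k \<Longrightarrow> f i \<in> polyfun" and ind: "\<not> alg_dependent (Z k) k f"
    by (auto simp: less_Suc_eq)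
  have sub: "Z k \<subset> Z (Suc k)" using Suc.prems by auto
  obtain C where C: "zariski_closed C" "Z k = X \<inter> C"
    using Suc.prems(1)[of k] unfolding rel_closed_def by auto
  obtain w where w: "w \<in> Z (Suc k)" "w \<notin> Z k" using sub by auto
  have "Z (Suc k) \<subseteq> X" using Suc.prems(1)[of "Suc k"] unfolding rel_closed_def by auto
  then have "w \<notin> C" using w C by auto
  then obtain h where h: "h \<in> polyfun" "h w \<noteq> 0" "\<And>z. z \<in> C \<Longrightarrow> h z = 0"
    using C(1) unfolding zariski_closed_def by blast
  define f' where "f' = f(k := h)"
  have "\<not> alg_dependent (Z (Suc k)) (Suc k) f'"
  proof
    assume "alg_dependent (Z (Suc k)) (Suc k) f'"
    then have "alg_dependent (Z k) k f'"
      by (rule alg_dependent_restrict[rotated -1, where w = w])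
         (use Suc.prems(1)[of "Suc k"] sub f h w C in \<open>auto simp: f'_def le_less\<close>)
    moreover have "monom_fun f' k = monom_fun f k"
      unfolding monom_fun_def f'_def by (auto simp: fun_eq_iff)
    ultimately show False using ind unfolding alg_dependent_def by simp
  qed
  moreover have "\<forall>i<Suc k. f' i \<in> polyfun" using f h by (auto simp: f'_def less_Suc_eq)
  ultimately show ?case by (intro exI[of _ f'] conjI)
qed

section \<open>Counting monomials: more polynomials than variables are algebraically
  dependent\<close>

lemma homogeneous_system_nontrivial_solution:
  fixes A :: "'e \<Rightarrow> 'b \<Rightarrow> 'a::field"
  assumes "finite B" "finite E" "card B < card E"
  shows "\<exists>l. (\<exists>e\<in>E. l e \<noteq> 0) \<and> (\<forall>b\<in>B. (\<Sum>e\<in>E. l e * A e b) = 0)"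
  using assms
proof (induction B arbitrary: E A rule: finite_induct)
  case empty
  then obtain e where "e \<in> E" by (metis card.empty ex_in_conv less_irrefl)
  then show ?case by (intro exI[of _ "\<lambda>_. 1"]) auto
next
  case (insert b B)
  show ?case
  proof (cases "\<forall>e\<in>E. A e b = 0")
    case True
    obtain l where "\<exists>e\<in>E. l e \<noteq> 0" "\<forall>b\<in>B. (\<Sum>e\<in>E. l e * A e b) = 0"
      using insert.IH[of E A] insert.prems insert.hyps by auto
    then show ?thesis using True by (intro exI[of _ l]) auto
  next
    case False
    then obtain e0 where e0: "e0 \<in> E" "A e0 b \<noteq> 0" by auto
    \<comment> \<open>Elimination of the unknown \<open>e0\<close> by equation \<open>b\<close>: the
      coefficients \<open>A'\<close> are zero in that equation, and the value of \<open>l'\<close>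
      at \<open>e0\<close> is the one it forces.\<close>
    define A' where "A' e c = A e c - A e b / A e0 b * A e0 c" for e c
    obtain l where l: "\<exists>e\<in>E - {e0}. l e \<noteq> 0"
      "\<forall>c\<in>B. (\<Sum>e\<in>E - {e0}. l e * A' e c) = 0"
    proof -
      have "card B < card (E - {e0})" using insert.prems insert.hyps e0 by (simp add: card_Diff_singleton)
      then have "\<exists>l. (\<exists>e\<in>E - {e0}. l e \<noteq> 0) \<and> (\<forall>c\<in>B. (\<Sum>e\<in>E - {e0}. l e * A' e c) = 0)"
        using insert.IH[of "E - {e0}" A'] insert.prems by simp
      then show ?thesis using that by blast
    qed
    define l' where "l' = l(e0 := - (\<Sum>e\<in>E - {e0}. l e * A e b) / A e0 b)"
    have split: "(\<Sum>e\<in>E. l' e * A e c) = l' e0 * A e0 c + (\<Sum>e\<in>E - {e0}. l e * A e c)" for c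
    proof -
      have "(\<Sum>e\<in>E. l' e * A e c) = l' e0 * A e0 c + (\<Sum>e\<in>E - {e0}. l' e * A e c)"
        using insert.prems e0 by (simp add: sum.remove)
      also have "(\<Sum>e\<in>E - {e0}. l' e * A e c) = (\<Sum>e\<in>E - {e0}. l e * A e c)"
        by (rule sum.cong) (auto simp: l'_def)
      finally show ?thesis .
    qed
    have "(\<Sum>e\<in>E. l' e * A e c) = (\<Sum>e\<in>E - {e0}. l e * A' e c)" for c
    proof -
      have "l' e0 * A e0 c = - (\<Sum>e\<in>E - {e0}. l e * (A e b / A e0 b * A e0 c))"
        by (simp add: l'_def sum_distrib_right sum_divide_distrib mult.assoc)
      then show ?thesis
        by (subst split) (simp add: A'_def right_diff_distrib sum_subtractf)
    qed
    moreover have "A' e b = 0" for e using e0 by (simp add: A'_def)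
    ultimately have "\<forall>c\<in>insert b B. (\<Sum>e\<in>E. l' e * A e c) = 0"
      using l(2) by auto
    moreover have "\<exists>e\<in>E. l' e \<noteq> 0" using l(1) by (auto simp: l'_def)
    ultimately show ?thesis by blast
  qed
qed

text \<open>Bounding each exponent, rather than the total degree, makes the box a power of
  \<open>{..D}\<close> with an exact cardinality.\<close>

definition expo_box :: "nat \<Rightarrow> nat \<Rightarrow> (nat \<Rightarrow> nat) set" where
  "expo_box n D = {e. (\<forall>j<n. e j \<le> D) \<and> (\<forall>j\<ge>n. e j = 0)}"

lemma expo_box_finite_card: "finite (expo_box n D) \<and> card (expo_box n D) = Suc D ^ n"
proof -
  \<comment> \<open>\<open>r\<close> trades the padding \<open>undefined\<close> of
    \<open>PiE\<close> for the padding zero of \<open>expo_box\<close>.\<close>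
  define r where "r f j = (if j < n then f j else 0)" for f :: "nat \<Rightarrow> nat" and j
  let ?P = "PiE {..<n} (\<lambda>_. {..D})"
  have inj: "inj_on r ?P"
  proof (rule inj_onI)
    fix f g assume *: "f \<in> ?P" "g \<in> ?P" "r f = r g"
    show "f = g"
      by (rule PiE_ext[OF *(1,2)]) (use *(3) in \<open>auto simp: r_def fun_eq_iff split: if_splits\<close>)
  qed
  have "expo_box n D = r ` ?P"
  proof (intro equalityI subsetI)
    fix e assume e: "e \<in> expo_box n D"
    have "e = r (restrict e {..<n})" using e by (auto simp: r_def expo_box_def fun_eq_iff)
    moreover have "restrict e {..<n} \<in> ?P" using e by (auto simp: expo_box_def)
    ultimately show "e \<in> r ` ?P" by blast
  qed (auto simp: r_def expo_box_def PiE_def Pi_def)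
  then show ?thesis
    using inj by (simp add: card_image card_PiE finite_PiE)
qed

text \<open>Only points of the coordinate subspace are tested, so a variable of index at least
  \<open>n\<close> counts as the zero polynomial. \<open>D\<close> bounds the degree in each
  variable separately.\<close>

definition poly_deg :: "nat \<Rightarrow> nat \<Rightarrow> ((nat \<Rightarrow> 'a::comm_ring_1) \<Rightarrow> 'a) \<Rightarrow> bool" where
  "poly_deg n D p \<longleftrightarrow> (\<exists>c. \<forall>x. (\<forall>j\<ge>n. x j = 0) \<longrightarrow>
     p x = (\<Sum>e\<in>expo_box n D. c e * (\<Prod>j<n. x j ^ e j)))"

text \<open>Monomials may be listed with repetitions, as they arise from a product; terms of equal
  exponent are collected.\<close>

lemma poly_degI:
  fixes p :: "(nat \<Rightarrow> 'a::comm_ring_1) \<Rightarrow> 'a"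
  assumes "finite A" "\<And>a. a \<in> A \<Longrightarrow> h a \<in> expo_box n D"
    and "\<And>x. (\<forall>j\<ge>n. x j = 0) \<Longrightarrow> p x = (\<Sum>a\<in>A. c a * (\<Prod>j<n. x j ^ h a j))"
  shows "poly_deg n D p"
  unfolding poly_deg_def
proof (intro exI allI impI)
  fix x :: "nat \<Rightarrow> 'a" assume x: "\<forall>j\<ge>n. x j = 0"
  have "(\<Sum>a\<in>A. c a * (\<Prod>j<n. x j ^ h a j))
      = (\<Sum>e\<in>expo_box n D. \<Sum>a | a \<in> A \<and> h a = e. c a * (\<Prod>j<n. x j ^ h a j))"
    by (rule sum.group[symmetric]) (use assms expo_box_finite_card in auto)
  also have "\<dots> = (\<Sum>e\<in>expo_box n D. (\<Sum>a | a \<in> A \<and> h a = e. c a) * (\<Prod>j<n. x j ^ e j))"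
    by (auto simp: sum_distrib_right intro!: sum.cong)
  finally show "p x = (\<Sum>e\<in>expo_box n D. (\<Sum>a | a \<in> A \<and> h a = e. c a) * (\<Prod>j<n. x j ^ e j))"
    using assms(3)[OF x] by simp
qed

lemma poly_deg_mono:
  assumes "poly_deg n D p" "D \<le> D'"
  shows "poly_deg n D' p"
proof -
  obtain c where c: "\<forall>x. (\<forall>j\<ge>n. x j = 0) \<longrightarrow> p x = (\<Sum>e\<in>expo_box n D. c e * (\<Prod>j<n. x j ^ e j))"
    using assms(1) unfolding poly_deg_def by blast
  show ?thesis
    by (rule poly_degI[of "expo_box n D" "\<lambda>e. e" _ _ _ c])
       (use c assms(2) expo_box_finite_card in \<open>auto simp: expo_box_def intro: order_trans\<close>)
qed

lemma poly_deg_const: "poly_deg n D (\<lambda>x. c)"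
  by (rule poly_degI[of "{()}" "\<lambda>_ _. 0" _ _ _ "\<lambda>_. c"]) (auto simp: expo_box_def)

lemma poly_deg_var: "poly_deg n 1 (\<lambda>x :: nat \<Rightarrow> 'a::comm_ring_1. x i)"
proof (cases "i < n")
  case True
  have "(\<Prod>j<n. x j ^ (if j = i then 1 else 0)) = x i" for x :: "nat \<Rightarrow> 'a"
  proof -
    have "(\<Prod>j<n. x j ^ (if j = i then 1 else 0)) = (\<Prod>j<n. if j = i then x j else 1)"
      by (rule prod.cong) auto
    then show ?thesis using True by simp
  qed
  then show ?thesis using True
    by (intro poly_degI[of "{()}" "\<lambda>_ j. if j = i then 1 else 0" _ _ _ "\<lambda>_. 1"])
       (auto simp: expo_box_def)
next
  case False
  then show ?thesis
    by (intro poly_degI[of "{()}" "\<lambda>_ _. 0" _ _ _ "\<lambda>_. 0"]) (auto simp: expo_box_def)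
qed

lemma poly_deg_add:
  assumes "poly_deg n D p" "poly_deg n D q"
  shows "poly_deg n D (\<lambda>x. p x + q x)"
proof -
  obtain c where c: "\<forall>x. (\<forall>j\<ge>n. x j = 0) \<longrightarrow> p x = (\<Sum>e\<in>expo_box n D. c e * (\<Prod>j<n. x j ^ e j))"
    using assms(1) unfolding poly_deg_def by blast
  obtain d where d: "\<forall>x. (\<forall>j\<ge>n. x j = 0) \<longrightarrow> q x = (\<Sum>e\<in>expo_box n D. d e * (\<Prod>j<n. x j ^ e j))"
    using assms(2) unfolding poly_deg_def by blast
  show ?thesis unfolding poly_deg_def
    by (rule exI[of _ "\<lambda>e. c e + d e"]) (use c d in \<open>simp add: sum.distrib distrib_right\<close>)
qed

lemma poly_deg_mult:
  fixes p :: "(nat \<Rightarrow> 'a::comm_ring_1) \<Rightarrow> 'a"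
  assumes "poly_deg n D p" "poly_deg n D' q"
  shows "poly_deg n (D + D') (\<lambda>x. p x * q x)"
proof -
  obtain c where c: "\<forall>x. (\<forall>j\<ge>n. x j = 0) \<longrightarrow> p x = (\<Sum>e\<in>expo_box n D. c e * (\<Prod>j<n. x j ^ e j))"
    using assms(1) unfolding poly_deg_def by blast
  obtain d where d: "\<forall>x. (\<forall>j\<ge>n. x j = 0) \<longrightarrow> q x = (\<Sum>e\<in>expo_box n D'. d e * (\<Prod>j<n. x j ^ e j))"
    using assms(2) unfolding poly_deg_def by blast
  show ?thesis
  proof (rule poly_degI[of "expo_box n D \<times> expo_box n D'" "\<lambda>(e, e') j. e j + e' j" _ _ _
        "\<lambda>(e, e'). c e * d e'"])
    fix x :: "nat \<Rightarrow> 'a" assume x: "\<forall>j\<ge>n. x j = 0"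
    have "p x * q x = (\<Sum>e\<in>expo_box n D. \<Sum>e'\<in>expo_box n D'.
        (c e * (\<Prod>j<n. x j ^ e j)) * (d e' * (\<Prod>j<n. x j ^ e' j)))"
      using c d x by (simp add: sum_product)
    also have "\<dots> = (\<Sum>(e, e')\<in>expo_box n D \<times> expo_box n D'.
        (c e * (\<Prod>j<n. x j ^ e j)) * (d e' * (\<Prod>j<n. x j ^ e' j)))"
      by (rule sum.cartesian_product)
    also have "\<dots> = (\<Sum>a\<in>expo_box n D \<times> expo_box n D'. (case a of (e, e') \<Rightarrow> c e * d e') *
        (\<Prod>j<n. x j ^ (case a of (e, e') \<Rightarrow> \<lambda>j. e j + e' j) j))"
      by (rule sum.cong) (auto simp: power_add prod.distrib mult_ac)
    finally show "p x * q x = (\<Sum>a\<in>expo_box n D \<times> expo_box n D'. (case a of (e, e') \<Rightarrow> c e * d e') *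
        (\<Prod>j<n. x j ^ (case a of (e, e') \<Rightarrow> \<lambda>j. e j + e' j) j))" .
  qed (auto simp: expo_box_finite_card, auto simp: expo_box_def add_mono)
qed

lemma polyfun_poly_deg:
  assumes "p \<in> polyfun"
  shows "\<exists>D. poly_deg n D p"
  using assms
proof (induction p)
  case (pf_const c)
  show ?case using poly_deg_const by blast
next
  case (pf_var i)
  show ?case using poly_deg_var by blast
next
  case (pf_add p q)
  then obtain D D' where "poly_deg n D p" "poly_deg n D' q" by blast
  then have "poly_deg n (max D D') p" "poly_deg n (max D D') q"
    by (auto elim: poly_deg_mono)
  then have "poly_deg n (max D D') (\<lambda>x. p x + q x)" by (rule poly_deg_add)
  then show ?case by (rule exI)
next
  case (pf_mult p q)
  then obtain D D' where "poly_deg n D p" "poly_deg n D' q" by blast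
  then have "poly_deg n (D + D') (\<lambda>x. p x * q x)" by (rule poly_deg_mult)
  then show ?case by (rule exI)
qed

lemma poly_deg_power:
  assumes "poly_deg n D p"
  shows "poly_deg n (m * D) (\<lambda>x. p x ^ m)"
proof (induction m)
  case (Suc m)
  show ?case using poly_deg_mult[OF assms Suc] by (simp add: add.commute)
qed (simp add: poly_deg_const)

lemma poly_deg_monom_fun:
  assumes "\<And>i. i < k \<Longrightarrow> poly_deg n D (f i)" and "\<And>i. i < k \<Longrightarrow> e i \<le> N"
  shows "poly_deg n (k * (N * D)) (monom_fun f k e)"
proof -
  have "poly_deg n (m * (N * D)) (\<lambda>x. \<Prod>i<m. f i x ^ e i)" if "m \<le> k" for m
    using that
  proof (induction m)
    case (Suc m)
    have "poly_deg n (N * D) (\<lambda>x. f m x ^ e m)"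
      by (rule poly_deg_mono[OF poly_deg_power[OF assms(1)]]) (use assms(2) Suc.prems in auto)
    from poly_deg_mult[OF Suc.IH this] Suc.prems show ?case
      by (simp add: algebra_simps)
  qed (simp add: poly_deg_const)
  then show ?thesis unfolding monom_fun_def[abs_def] by simp
qed

text \<open>There are \<open>(N + 1)\<^sup>k\<close> monomials of degree at most \<open>N\<close> in each of \<open>f\<^sub>0, \<dots>, f\<^sub>k\<^sub>-\<^sub>1\<close>, and they live
  in a space of dimension \<open>O(N\<^sup>n)\<close>.\<close>
lemma alg_dependent_coordinate_space:
  fixes f :: "nat \<Rightarrow> (nat \<Rightarrow> 'a::field) \<Rightarrow> 'a"
  assumes "n < k" and f: "\<And>i. i < k \<Longrightarrow> f i \<in> polyfun"
  shows "alg_dependent {x. \<forall>j\<ge>n. x j = 0} k f"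
proof -
  obtain D where D: "\<And>i. i < k \<Longrightarrow> poly_deg n (D i) (f i)"
    using polyfun_poly_deg[OF f, of _ n] by metis
  define D0 where "D0 = Max (D ` {..<k})"
  have D0: "poly_deg n D0 (f i)" if "i < k" for i
    by (rule poly_deg_mono[OF D[OF that]]) (use that in \<open>auto simp: D0_def\<close>)
  \<comment> \<open>This \<open>N\<close> makes the count work:
    \<open>Suc M \<le> (k * D0 + 1) * Suc N\<close>, so \<open>Suc M ^ n \<le> N * Suc N ^ n < Suc N
    ^ Suc n \<le> Suc N ^ k\<close>.\<close>
  define N where "N = (k * D0 + 1) ^ n"
  define M where "M = k * (N * D0)"
  have "\<exists>c. \<forall>x. (\<forall>j\<ge>n. x j = 0) \<longrightarrow>
      monom_fun f k e x = (\<Sum>\<alpha>\<in>expo_box n M. c \<alpha> * (\<Prod>j<n. x j ^ \<alpha> j))"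
    if "e \<in> expo_box k N" for e
    using poly_deg_monom_fun[of k n D0 f e N] that D0
    unfolding poly_deg_def M_def expo_box_def by blast
  then obtain A where A: "\<And>e x. e \<in> expo_box k N \<Longrightarrow> \<forall>j\<ge>n. x j = 0 \<Longrightarrow>
      monom_fun f k e x = (\<Sum>\<alpha>\<in>expo_box n M. A e \<alpha> * (\<Prod>j<n. x j ^ \<alpha> j))"
    by metis
  have "Suc M ^ n < Suc N ^ k"
  proof -
    have "Suc M \<le> (k * D0 + 1) * Suc N" unfolding M_def by (simp add: algebra_simps)
    then have "Suc M ^ n \<le> ((k * D0 + 1) * Suc N) ^ n" by (rule power_mono) simp
    also have "\<dots> = N * Suc N ^ n" by (simp only: power_mult_distrib N_def[symmetric])
    also have "\<dots> < Suc N * Suc N ^ n" by simp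
    also have "\<dots> = Suc N ^ Suc n" by simp
    also have "\<dots> \<le> Suc N ^ k" by (rule power_increasing) (use assms in auto)
    finally show ?thesis .
  qed
  then obtain l where l: "\<exists>e\<in>expo_box k N. l e \<noteq> 0"
    "\<forall>\<alpha>\<in>expo_box n M. (\<Sum>e\<in>expo_box k N. l e * A e \<alpha>) = 0"
    using homogeneous_system_nontrivial_solution[of "expo_box n M" "expo_box k N" A]
      expo_box_finite_card by auto
  define E where "E = {e \<in> expo_box k N. l e \<noteq> 0}"
  have "(\<Sum>e\<in>E. l e * monom_fun f k e x) = 0" if x: "\<forall>j\<ge>n. x j = 0" for x
  proof -
    have "(\<Sum>e\<in>E. l e * monom_fun f k e x) = (\<Sum>e\<in>expo_box k N. l e * monom_fun f k e x)"
      by (rule sum.mono_neutral_left) (use expo_box_finite_card in \<open>auto simp: E_def\<close>)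
    also have "\<dots> = (\<Sum>e\<in>expo_box k N. \<Sum>\<alpha>\<in>expo_box n M. l e * A e \<alpha> * (\<Prod>j<n. x j ^ \<alpha> j))"
      by (rule sum.cong) (auto simp: A x sum_distrib_left mult_ac)
    also have "\<dots> = (\<Sum>\<alpha>\<in>expo_box n M. (\<Sum>e\<in>expo_box k N. l e * A e \<alpha>) * (\<Prod>j<n. x j ^ \<alpha> j))"
      by (subst sum.swap) (simp add: sum_distrib_right)
    also have "\<dots> = 0" using l(2) by simp
    finally show ?thesis .
  qed
  moreover have "finite E" using expo_box_finite_card by (simp add: E_def)
  ultimately show ?thesis
    unfolding alg_dependent_def
    by (intro exI[of _ E] exI[of _ l] conjI) (use l(1) in \<open>auto simp: E_def expo_box_def\<close>)
qed

text \<open>Independence is tested on the parameters: a relation among the functions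
  \<open>f i (\<Phi> x)\<close> says that one polynomial \<open>H\<close> vanishes on the image of
  \<open>\<Phi>\<close>, hence on its closure, which contains \<open>X\<close>.\<close>

lemma zariski_dim_le_if_param:
  fixes X :: "('i \<Rightarrow> 'a::field) set" and \<Phi> :: "(nat \<Rightarrow> 'a) \<Rightarrow> 'i \<Rightarrow> 'a"
  assumes \<Phi>: "\<And>i. (\<lambda>x. \<Phi> x i) \<in> polyfun"
    and X: "X \<subseteq> zariski_closure (\<Phi> ` {x. \<forall>j\<ge>n. x j = 0})"
  shows "zariski_dim X \<le> enat n"
  unfolding zariski_dim_def
proof (rule Sup_least)
  fix d assume "d \<in> {enat k |k. \<exists>Z :: nat \<Rightarrow> ('i \<Rightarrow> 'a) set.
    (\<forall>i\<le>k. zariski_irreducible (Z i) \<and> rel_closed X (Z i)) \<and> (\<forall>i<k. Z i \<subset> Z (Suc i))}"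
  then obtain k and Z :: "nat \<Rightarrow> ('i \<Rightarrow> 'a) set" where d: "d = enat k"
    and Z: "\<And>i. i \<le> k \<Longrightarrow> zariski_irreducible (Z i) \<and> rel_closed X (Z i)"
    and strict: "\<And>i. i < k \<Longrightarrow> Z i \<subset> Z (Suc i)" by auto
  obtain f where f: "\<And>i. i < k \<Longrightarrow> f i \<in> polyfun" and ind: "\<not> alg_dependent (Z k) k f"
    using chain_algebraically_independent[of k Z X] Z strict by auto
  have "k \<le> n"
  proof (rule ccontr)
    assume "\<not> k \<le> n"
    then have "alg_dependent {x. \<forall>j\<ge>n. x j = 0} k (\<lambda>i x. f i (\<Phi> x))"
      by (intro alg_dependent_coordinate_space polyfun_compose[OF f \<Phi>]) auto
    then obtain E c where E: "finite E" "E \<noteq> {}" "\<forall>e\<in>E. c e \<noteq> 0" "\<forall>e\<in>E. \<forall>i\<ge>k. e i = 0"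
      and rel: "\<forall>x\<in>{x. \<forall>j\<ge>n. x j = 0}. (\<Sum>e\<in>E. c e * monom_fun (\<lambda>i x. f i (\<Phi> x)) k e x) = 0"
      unfolding alg_dependent_def by (elim exE conjE) (rule that)
    define H where "H y = (\<Sum>e\<in>E. c e * monom_fun f k e y)" for y
    have "H \<in> polyfun" unfolding H_def[abs_def]
      by (intro polyfun_sum pf_mult pf_const monom_fun_polyfun f)
    moreover have "H y = 0" if "y \<in> \<Phi> ` {x. \<forall>j\<ge>n. x j = 0}" for y
      using that rel by (auto simp: H_def monom_fun_def)
    ultimately have "H y = 0" if "y \<in> X" for y
      using zariski_closureD[of y _ H] X that by auto
    moreover have "Z k \<subseteq> X" using Z[of k] by (auto simp: rel_closed_def)
    ultimately have "\<forall>y\<in>Z k. H y = 0" by auto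
    then have "alg_dependent (Z k) k f"
      unfolding alg_dependent_def H_def using E by (intro exI[of _ E] exI[of _ c] conjI)
    then show False using ind by simp
  qed
  then show "d \<le> enat n" by (simp add: d)
qed

section \<open>Trilinear structures and the action of the general linear group\<close>

lemma bracket_add:
  "bracket mu (x + x') y z = bracket mu x y z + bracket mu x' y z"
  "bracket mu x (y + y') z = bracket mu x y z + bracket mu x y' z"
  "bracket mu x y (z + z') = bracket mu x y z + bracket mu x y z'"
  by (simp_all add: bracket_def vec_eq_iff algebra_simps sum.distrib)

lemma bracket_scale:
  "bracket mu (c *s x) y z = c *s bracket mu x y z"
  "bracket mu x (c *s y) z = c *s bracket mu x y z"
  "bracket mu x y (c *s z) = c *s bracket mu x y z"
  by (simp_all add: bracket_def vec_eq_iff sum_distrib_left mult_ac)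

lemma bracket_zero:
  "bracket mu 0 y z = 0" "bracket mu x 0 z = 0" "bracket mu x y 0 = 0"
  by (simp_all add: bracket_def vec_eq_iff)

lemma bracket_sum:
  "bracket mu (\<Sum>a\<in>A. f a) y z = (\<Sum>a\<in>A. bracket mu (f a) y z)"
  "bracket mu x (\<Sum>a\<in>A. f a) z = (\<Sum>a\<in>A. bracket mu x (f a) z)"
  "bracket mu x y (\<Sum>a\<in>A. f a) = (\<Sum>a\<in>A. bracket mu x y (f a))"
  by (induction A rule: infinite_finite_induct) (simp_all add: bracket_zero bracket_add)

lemma sum_axis_mult:
  "(\<Sum>a\<in>UNIV. axis i (1::'a::comm_ring_1) $ a * f a) = f (i::'n::finite)"
  "(\<Sum>a\<in>UNIV. f a * axis i (1::'a::comm_ring_1) $ a) = f (i::'n::finite)"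
  by (simp_all add: axis_def mult_if_delta mult.commute[of "f _"])

lemma bracket_axis: "bracket mu (axis i 1) (axis j 1) (axis k 1) $ l = mu (i, j, k, l)"
proof -
  have "bracket mu (axis i 1) (axis j 1) (axis k 1) $ l = (\<Sum>a\<in>UNIV. axis i 1 $ a *
      (\<Sum>b\<in>UNIV. axis j 1 $ b * (\<Sum>c\<in>UNIV. axis k 1 $ c * mu (a, b, c, l))))"
    by (simp add: bracket_def sum_distrib_left mult.assoc)
  then show ?thesis by (simp only: sum_axis_mult)
qed

lemma struct_eqI:
  fixes mu nu :: "('a::comm_ring_1, 'n::finite) struct"
  assumes "\<And>x y z. bracket mu x y z = bracket nu x y z"
  shows "mu = nu"
proof
  fix t :: "'n \<times> 'n \<times> 'n \<times> 'n"
  obtain i j k l where "t = (i, j, k, l)" by (metis prod.exhaust)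
  then show "mu t = nu t"
    using arg_cong[OF assms[of "axis i 1" "axis j 1" "axis k 1"], of "\<lambda>v. v $ l"]
    by (simp add: bracket_axis)
qed

text \<open>Decoupling the inverse from \<open>g\<close> makes the expression polynomial in all
  arguments; \<open>h\<close> is later the inverse, the adjugate or an explicit unitriangular
  matrix.\<close>

definition act2 :: "'a::field^'n^'n \<Rightarrow> 'a^'n^'n \<Rightarrow> ('a, 'n::finite) struct \<Rightarrow> ('a, 'n) struct" where
  "act2 g h mu = (\<lambda>(i, j, k, l).
     (g *v bracket mu (h *v axis i 1) (h *v axis j 1) (h *v axis k 1)) $ l)"

lemma gl_act_eq_act2: "gl_act g mu = act2 g (matrix_inv g) mu"
  by (simp add: gl_act_def act2_def)

lemma matrix_vector_mult_sum_scale: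
  fixes g :: "'a::field^'n^'n"
  shows "g *v (\<Sum>a\<in>A. f a) = (\<Sum>a\<in>A. g *v f a)" "g *v (c *s v) = c *s (g *v v)"
proof -
  show "g *v (\<Sum>a\<in>A. f a) = (\<Sum>a\<in>A. g *v f a)"
    by (induction A rule: infinite_finite_induct) (simp_all add: matrix_vector_right_distrib)
  show "g *v (c *s v) = c *s (g *v v)"
    by (simp add: matrix_vector_mult_def vec_eq_iff sum_distrib_left mult_ac)
qed

lemma bracket_act2:
  fixes mu :: "('a::field, 'n::finite) struct"
  shows "bracket (act2 g h mu) x y z = g *v bracket mu (h *v x) (h *v y) (h *v z)"
proof -
  have expand: "h *v v = (\<Sum>i\<in>UNIV. (v $ i) *s (h *v axis i 1))" for v :: "'a^'n"
    by (simp add: matrix_vector_mult_def vec_eq_iff sum_axis_mult mult.commute)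
  have e: "bracket mu (h *v x) u v = (\<Sum>i\<in>UNIV. x $ i *s bracket mu (h *v axis i 1) u v)"
    "bracket mu u (h *v y) v = (\<Sum>i\<in>UNIV. y $ i *s bracket mu u (h *v axis i 1) v)"
    "bracket mu u v (h *v z) = (\<Sum>i\<in>UNIV. z $ i *s bracket mu u v (h *v axis i 1))" for u v
    by (subst expand, simp only: bracket_sum bracket_scale)+
  show ?thesis
    unfolding e(1) unfolding e(2) unfolding e(3) bracket_def[of "act2 g h mu"]
    by (simp add: vec_eq_iff act2_def
        matrix_vector_mult_sum_scale sum_component sum_distrib_left mult_ac)
qed

lemma
  fixes g :: "'a::field^'n^'n"
  assumes "invertible g"
  shows matrix_inv_left: "matrix_inv g ** g = mat 1" and matrix_inv_right: "g ** matrix_inv g = mat 1"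
  using someI_ex[OF assms[unfolded invertible_def]] unfolding matrix_inv_def by simp_all

lemma matrix_inv_vec:
  assumes "invertible (g :: 'a::field^'n^'n)"
  shows "matrix_inv g *v (g *v x) = x" "g *v (matrix_inv g *v x) = x"
  by (simp_all add: matrix_vector_mul_assoc matrix_inv_left matrix_inv_right assms)

lemma matrix_inv_unique:
  fixes g :: "'a::field^'n^'n"
  assumes "g ** h = mat 1"
  shows "invertible g" "matrix_inv g = h" "invertible h"
proof -
  show g: "invertible g" using assms by (auto simp: invertible_right_inverse)
  show "invertible h" using assms by (auto simp: invertible_left_inverse)
  show "matrix_inv g = h"
    by (metis assms g matrix_inv_left matrix_mul_assoc matrix_mul_lid matrix_mul_rid)
qed

lemma bracket_gl_act:
  "bracket (gl_act g mu) x y z =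
     g *v bracket mu (matrix_inv g *v x) (matrix_inv g *v y) (matrix_inv g *v z)"
  by (simp add: gl_act_eq_act2 bracket_act2)

text \<open>An intertwining condition replaces the formula with the inverse, so concrete changes of
  basis are verified without inverting \<open>g\<close>.\<close>

lemma gl_act_eqI:
  assumes "invertible g"
    and "\<And>x y z. g *v bracket mu x y z = bracket nu (g *v x) (g *v y) (g *v z)"
  shows "gl_act g mu = nu"
  by (rule struct_eqI) (simp add: bracket_gl_act assms matrix_inv_vec)

lemma gl_act_mult:
  assumes "invertible g" "invertible h"
  shows "gl_act (g ** h) mu = gl_act g (gl_act h mu)"
  by (rule gl_act_eqI)
     (simp_all add: assms invertible_mult bracket_gl_act matrix_vector_mul_assoc[symmetric] matrix_inv_vec)

lemma gl_act_one: "gl_act (mat 1) mu = mu"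
  by (rule gl_act_eqI) (simp_all add: invertible_def exI[of _ "mat 1"])

lemma orbit_refl: "mu \<in> orbit mu"
  unfolding orbit_def using gl_act_one[of mu] matrix_inv_unique(1)[of "mat 1" "mat 1"]
  by (metis (mono_tags, lifting) matrix_mul_lid mem_Collect_eq)

lemma gl_act_in_orbit: "nu \<in> orbit mu \<Longrightarrow> invertible g \<Longrightarrow> gl_act g nu \<in> orbit mu"
  unfolding orbit_def by clarify (metis gl_act_mult invertible_mult)

lemma is_LTS_gl_act:
  assumes "is_LTS mu" "invertible g"
  shows "is_LTS (gl_act g mu)"
  unfolding is_LTS_def bracket_gl_act matrix_inv_vec[OF assms(2)] matrix_vector_right_distrib[symmetric]
proof (intro conjI allI)
  fix u v x y z
  let ?u = "matrix_inv g *v u" and ?v = "matrix_inv g *v v"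
  let ?x = "matrix_inv g *v x" and ?y = "matrix_inv g *v y" and ?z = "matrix_inv g *v z"
  note L = assms(1)[unfolded is_LTS_def]
  show "g *v (bracket mu ?x ?y ?z + bracket mu ?y ?x ?z) = 0"
    using L[THEN conjunct1, rule_format, of ?x ?y ?z] by simp
  show "g *v (bracket mu ?x ?y ?z + bracket mu ?y ?z ?x + bracket mu ?z ?x ?y) = 0"
    using L[THEN conjunct2, THEN conjunct1, rule_format, of ?x ?y ?z] by simp
  show "g *v bracket mu ?u ?v (bracket mu ?x ?y ?z) =
      g *v (bracket mu (bracket mu ?u ?v ?x) ?y ?z + bracket mu ?x (bracket mu ?u ?v ?y) ?z
        + bracket mu ?x ?y (bracket mu ?u ?v ?z))"
    using L[THEN conjunct2, THEN conjunct2, rule_format, of ?u ?v ?x ?y ?z] by simp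
qed

lemma polyfun_bracket:
  assumes "\<And>t. (\<lambda>s. M s t) \<in> polyfun" "\<And>i. (\<lambda>s. X s $ i) \<in> polyfun"
    "\<And>i. (\<lambda>s. Y s $ i) \<in> polyfun" "\<And>i. (\<lambda>s. Z s $ i) \<in> polyfun"
  shows "(\<lambda>s. bracket (M s) (X s) (Y s) (Z s) $ l) \<in> polyfun"
  unfolding bracket_def by (simp, intro polyfun_sum pf_mult assms)

lemma polyfun_matrix_vector:
  fixes G :: "('i \<Rightarrow> 'a) \<Rightarrow> 'a::comm_ring_1^'n^'m"
  assumes "\<And>i j. (\<lambda>s. G s $ i $ j) \<in> polyfun" "\<And>i. (\<lambda>s. X s $ i) \<in> polyfun"
  shows "(\<lambda>s. (G s *v X s) $ l) \<in> polyfun"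
  unfolding matrix_vector_mult_def by (simp, intro polyfun_sum pf_mult assms)

lemma polyfun_act2:
  assumes "\<And>t. (\<lambda>s. M s t) \<in> polyfun" "\<And>i j. (\<lambda>s. G s $ i $ j) \<in> polyfun"
    "\<And>i j. (\<lambda>s. H s $ i $ j) \<in> polyfun"
  shows "(\<lambda>s. act2 (G s) (H s) (M s) t) \<in> polyfun"
  unfolding act2_def
  by (cases t) (simp, intro polyfun_matrix_vector polyfun_bracket assms pf_const)

lemma polyfun_gl_act: "(\<lambda>mu. gl_act g mu t) \<in> polyfun"
  unfolding gl_act_eq_act2 by (intro polyfun_act2 pf_const pf_var)

lemma polyfun_det:
  fixes G :: "('i \<Rightarrow> 'a) \<Rightarrow> 'a::comm_ring_1^'n^'n"
  assumes "\<And>i j. (\<lambda>s. G s $ i $ j) \<in> polyfun"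
  shows "(\<lambda>s. det (G s)) \<in> polyfun"
  unfolding det_def by (intro polyfun_sum pf_mult polyfun_prod pf_const assms)

lemma gl_act_closure:
  assumes "invertible g" "\<And>nu. nu \<in> S \<Longrightarrow> gl_act g nu \<in> S" "mu \<in> zariski_closure S"
  shows "gl_act g mu \<in> zariski_closure S"
  by (rule zariski_closure_image[OF polyfun_gl_act _ assms(3)])
     (use assms(2) zariski_closure_superset in blast)

section \<open>Orbits as polynomial images by means of the adjugate\<close>

definition adjm :: "'a::field^'n^'n \<Rightarrow> 'a^'n^'n" where
  "adjm g = (\<chi> k i. det (\<chi> a b. if b = k then axis i 1 $ a else g $ a $ b))"

text \<open>The entries of \<open>adjm g\<close> are the numerators in Cramer's rule for
  \<open>g *v x = axis i 1\<close>.\<close>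

lemma adjm_eq:
  fixes g :: "'a::field^'n^'n"
  assumes "invertible g"
  shows "adjm g = (\<chi> i j. det g * matrix_inv g $ i $ j)"
proof -
  have d: "det g \<noteq> 0" using assms by (simp add: invertible_det_nz)
  have "matrix_inv g $ k $ i = adjm g $ k $ i / det g" for k i
  proof -
    have "g *v (matrix_inv g *v axis i 1) = axis i 1" by (simp add: matrix_inv_vec assms)
    then have "matrix_inv g *v axis i 1 = (\<chi> k. adjm g $ k $ i / det g)"
      using cramer[OF d] by (simp add: adjm_def)
    then have "(matrix_inv g *v axis i 1) $ k = adjm g $ k $ i / det g" by simp
    then show ?thesis
      by (simp add: matrix_vector_mult_def sum_axis_mult)
  qed
  then show ?thesis using d by (simp add: vec_eq_iff)
qed

lemma polyfun_adjm:
  fixes G :: "('i \<Rightarrow> 'a) \<Rightarrow> 'a::field^'n^'n"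
  assumes "\<And>i j. (\<lambda>s. G s $ i $ j) \<in> polyfun"
  shows "(\<lambda>s. adjm (G s) $ k $ i) \<in> polyfun"
proof -
  have "(\<lambda>s. if b = k then axis i 1 $ a else G s $ a $ b) \<in> polyfun" for a b
    using assms by (cases "b = k") (auto intro: pf_const)
  then show ?thesis
    unfolding adjm_def using polyfun_det[of "\<lambda>s. \<chi> a b. if b = k then axis i 1 $ a else G s $ a $ b"]
    by simp
qed

text \<open>By trilinearity each of the three arguments contributes one factor
  \<open>det g\<close>.\<close>

lemma act2_adjm:
  assumes "invertible g"
  shows "act2 g (adjm g) mu = gl_act g (\<lambda>t. det g ^ 3 * mu t)"
proof (rule struct_eqI)
  fix x y z
  have a: "adjm g *v v = det g *s (matrix_inv g *v v)" for v
    by (simp add: adjm_eq[OF assms] vec_eq_iff matrix_vector_mult_def sum_distrib_left mult_ac)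
  have b: "bracket (\<lambda>t. c * mu t) u v w = c *s bracket mu u v w" for c u v w
    by (simp add: bracket_def vec_eq_iff sum_distrib_left mult_ac)
  show "bracket (act2 g (adjm g) mu) x y z = bracket (gl_act g (\<lambda>t. det g ^ 3 * mu t)) x y z"
    unfolding bracket_act2 bracket_gl_act a b
    by (simp add: bracket_scale matrix_vector_mult_sum_scale power3_eq_cube mult_ac)
qed

text \<open>The adjugate makes \<open>g \<mapsto> det g ^ 3 * (g * mu)\<close> polynomial in \<open>g\<close>; closure of the family under
  scaling absorbs the factor \<open>det g ^ 3\<close>.\<close>
lemma irreducible_union_of_orbits:
  fixes \<tau> :: "(nat \<Rightarrow> 'a::field) \<Rightarrow> ('a, 'n::finite) struct"
  assumes inf: "infinite (UNIV :: 'a set)"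
    and \<tau>: "\<And>t. (\<lambda>x. \<tau> x t) \<in> polyfun" and \<delta>: "\<delta> \<in> polyfun" "\<delta> x0 \<noteq> 0"
    and scale: "\<And>x c. \<delta> x \<noteq> 0 \<Longrightarrow> c \<noteq> 0 \<Longrightarrow> \<exists>x'. \<delta> x' \<noteq> 0 \<and> \<tau> x' = (\<lambda>t. c * \<tau> x t)"
  shows "zariski_irreducible (\<Union>x\<in>{x. \<delta> x \<noteq> 0}. orbit (\<tau> x))"
proof -
  \<comment> \<open>One affine space carries the matrix entries and the parameters, so its
    irreducibility covers both at once.\<close>
  define G :: "(('n \<times> 'n) + nat \<Rightarrow> 'a) \<Rightarrow> 'a^'n^'n" where "G s = (\<chi> i j. s (Inl (i, j)))" for s
  define \<xi> where "\<xi> s = act2 (G s) (adjm (G s)) (\<tau> (\<lambda>i. s (Inr i)))" for s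
  define d where "d s = det (G s) * \<delta> (\<lambda>i. s (Inr i))" for s
  have G: "(\<lambda>s. G s $ i $ j) \<in> polyfun" for i j by (simp add: G_def pf_var)
  have \<xi>: "(\<lambda>s. \<xi> s t) \<in> polyfun" for t
    unfolding \<xi>_def by (intro polyfun_act2 polyfun_adjm G polyfun_compose[OF \<tau>] pf_var)
  have d: "d \<in> polyfun"
    unfolding d_def[abs_def] by (intro pf_mult polyfun_det G polyfun_compose[OF \<delta>(1)] pf_var)
  define join where "join g x = (\<lambda>i. case i of Inl (a, b) \<Rightarrow> (g :: 'a^'n^'n) $ a $ b | Inr n \<Rightarrow> x n)"
    for g and x :: "nat \<Rightarrow> 'a"
  have join: "G (join g x) = g" "(\<lambda>i. join g x (Inr i)) = x" for g x
    by (simp_all add: G_def join_def vec_eq_iff)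
  have "d (join (mat 1) x0) \<noteq> 0" unfolding d_def join using \<delta>(2) by simp
  then have "zariski_irreducible (\<xi> ` {s. d s \<noteq> 0})"
    by (intro zariski_irreducible_image[OF zariski_irreducible_principal_open[OF inf d]] \<xi>)
  moreover have "\<xi> ` {s. d s \<noteq> 0} = (\<Union>x\<in>{x. \<delta> x \<noteq> 0}. orbit (\<tau> x))"
  proof (intro equalityI subsetI)
    fix mu assume "mu \<in> \<xi> ` {s. d s \<noteq> 0}"
    then obtain s where s: "mu = \<xi> s" "det (G s) \<noteq> 0" "\<delta> (\<lambda>i. s (Inr i)) \<noteq> 0" by (auto simp: d_def)
    then have inv: "invertible (G s)" by (simp add: invertible_det_nz)
    obtain x' where x': "\<delta> x' \<noteq> 0" "\<tau> x' = (\<lambda>t. det (G s) ^ 3 * \<tau> (\<lambda>i. s (Inr i)) t)"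
      using scale[OF s(3), of "det (G s) ^ 3"] s(2) by auto
    have "mu = gl_act (G s) (\<tau> x')"
      unfolding s(1) \<xi>_def act2_adjm[OF inv] x'(2) ..
    then show "mu \<in> (\<Union>x\<in>{x. \<delta> x \<noteq> 0}. orbit (\<tau> x))"
      using x'(1) inv unfolding orbit_def by auto
  next
    fix mu assume "mu \<in> (\<Union>x\<in>{x. \<delta> x \<noteq> 0}. orbit (\<tau> x))"
    then obtain x g where x: "\<delta> x \<noteq> 0" "invertible g" "mu = gl_act g (\<tau> x)"
      unfolding orbit_def by auto
    have dg: "det g \<noteq> 0" using x by (simp add: invertible_det_nz)
    \<comment> \<open>The parameter is rescaled in advance by the factor that the adjugate puts
      back.\<close>
    obtain x' where x': "\<delta> x' \<noteq> 0" "\<tau> x' = (\<lambda>t. inverse (det g ^ 3) * \<tau> x t)"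
      using scale[OF x(1), of "inverse (det g ^ 3)"] dg by auto
    have "\<xi> (join g x') = mu"
      unfolding \<xi>_def join act2_adjm[OF x(2)] x'(2) x(3)
      using dg by (simp add: mult.assoc[symmetric])
    moreover have "d (join g x') \<noteq> 0" unfolding d_def join using dg x' by simp
    ultimately show "mu \<in> \<xi> ` {s. d s \<noteq> 0}" by (metis (mono_tags) imageI mem_Collect_eq)
  qed
  ultimately show ?thesis by simp
qed

lemma orbit_subset_closure_if_generic:
  fixes mu :: "('a::field, 'n::finite) struct"
  assumes inf: "infinite (UNIV :: 'a set)"
    and P: "P \<in> polyfun" "P s0 \<noteq> 0"
    and inv0: "det ((\<chi> i j. s0 (i, j)) :: 'a^'n^'n) \<noteq> 0"
    and gen: "\<And>(g :: 'a^'n^'n) c. invertible g \<Longrightarrow> P (\<lambda>(i, j). g $ i $ j) \<noteq> 0 \<Longrightarrow> c \<noteq> 0 \<Longrightarrow>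
      gl_act g (\<lambda>t. c * mu t) \<in> S"
  shows "orbit mu \<subseteq> zariski_closure S"
proof
  fix nu assume "nu \<in> orbit mu"
  then obtain g0 where g0: "invertible g0" "nu = gl_act g0 mu" unfolding orbit_def by auto
  \<comment> \<open>Cancels the factor \<open>det g0 ^ 3\<close> of the adjugate action at
    \<open>g0\<close>.\<close>
  define c where "c = inverse (det g0 ^ 3)"
  have c: "c \<noteq> 0" "det g0 ^ 3 * c = 1" using g0(1) by (simp_all add: c_def invertible_det_nz)
  define G :: "('n \<times> 'n \<Rightarrow> 'a) \<Rightarrow> 'a^'n^'n" where "G s = (\<chi> i j. s (i, j))" for s
  have G: "(\<lambda>s. G s $ i $ j) \<in> polyfun" for i j by (simp add: G_def pf_var)
  have PG: "(\<lambda>(i, j). G s $ i $ j) = s" for s by (auto simp: G_def)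
  show "nu \<in> zariski_closure S"
  proof (rule zariski_closureI)
    fix q assume q: "q \<in> polyfun" "\<And>a. a \<in> S \<Longrightarrow> q a = 0"
    define Q where "Q s = q (act2 (G s) (adjm (G s)) (\<lambda>t. c * mu t))" for s
    have Q: "Q \<in> polyfun"
      unfolding Q_def[abs_def] by (intro polyfun_compose[OF q(1)] polyfun_act2 polyfun_adjm G pf_const)
    have "Q s = 0" if s: "det (G s) * P s \<noteq> 0" for s
    proof -
      have inv: "invertible (G s)" using s by (simp add: invertible_det_nz)
      have "gl_act (G s) (\<lambda>t. (det (G s) ^ 3 * c) * mu t) \<in> S"
        by (rule gen[OF inv]) (use s c(1) in \<open>simp_all add: PG\<close>)
      then show ?thesis unfolding Q_def act2_adjm[OF inv] using q(2) by (simp add: mult.assoc)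
    qed
    then have "Q s = 0" for s
      using polyfun_eq_0_if_mult[OF inf pf_mult[OF polyfun_det[of G, OF G] P(1)] Q, of s0 s] P(2) inv0
      by (simp add: G_def)
    then have "Q (\<lambda>(i, j). g0 $ i $ j) = 0" .
    moreover have "G (\<lambda>(i, j). g0 $ i $ j) = g0" by (simp add: G_def vec_eq_iff)
    ultimately show "q nu = 0"
      unfolding Q_def using g0 c(2) by (simp add: act2_adjm mult.assoc[symmetric])
  qed
qed

section \<open>Structures adapted to a flag in dimension four\<close>

lemma struct_ext: "(\<And>i j k l. mu (i, j, k, l) = nu (i, j, k, l)) \<Longrightarrow> mu = nu"
  by (auto simp: fun_eq_iff)

lemma UNIV_4': "(UNIV :: 4 set) = {0, 1, 2, 3}"
proof -
  have "(4::4) = 0" by simp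
  then show ?thesis using UNIV_4 by (metis insert_commute)
qed

lemma sum_4': "sum f (UNIV :: 4 set) = f 0 + f 1 + f 2 + f 3"
  unfolding UNIV_4' by (simp add: add.assoc)

lemma all_4': "(\<forall>i::4. P i) \<longleftrightarrow> P 0 \<and> P 1 \<and> P 2 \<and> P 3"
  using UNIV_4' by (metis UNIV_I empty_iff insert_iff)

lemma vec_eq_4: "(x :: 'a^4) = y \<longleftrightarrow> x $ 0 = y $ 0 \<and> x $ 1 = y $ 1 \<and> x $ 2 = y $ 2 \<and> x $ 3 = y $ 3"
  by (simp add: vec_eq_iff all_4')

definition vec4 :: "'a \<Rightarrow> 'a \<Rightarrow> 'a \<Rightarrow> 'a \<Rightarrow> 'a^4" where
  "vec4 a b c d = (\<chi> i. if i = 0 then a else if i = 1 then b else if i = 2 then c else d)"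

lemma vec4_nth [simp]:
  "vec4 a b c d $ 0 = a" "vec4 a b c d $ 1 = b" "vec4 a b c d $ 2 = c" "vec4 a b c d $ 3 = d"
  by (simp_all add: vec4_def)

lemma axis_4:
  "axis 0 1 = vec4 1 0 0 (0::'a::zero_neq_one)" "axis 1 1 = vec4 0 1 0 (0::'a)"
  "axis 2 1 = vec4 0 0 1 (0::'a)" "axis 3 1 = vec4 0 0 0 (1::'a)"
  by (simp_all add: vec_eq_4 axis_def)

lemma matrix_vector_4:
  "((g :: 'a::comm_ring_1^4^4) *v x) $ i = g $ i $ 0 * x $ 0 + g $ i $ 1 * x $ 1 + g $ i $ 2 * x $ 2 + g $ i $ 3 * x $ 3"
  by (simp add: matrix_vector_mult_def sum_4')

text \<open>Pluecker coordinates of \<open>x\<close> and \<open>y\<close>; the brackets in an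
  adapted basis depend on the first two arguments only through them.\<close>

definition wedge :: "'a::comm_ring_1^4 \<Rightarrow> 'a^4 \<Rightarrow> 4 \<Rightarrow> 4 \<Rightarrow> 'a" where
  "wedge x y i j = x $ i * y $ j - x $ j * y $ i"

text \<open>In the basis \<open>e\<^sub>0, \<dots>, e\<^sub>3\<close>: every product lies in \<open>\<langle>e\<^sub>2, e\<^sub>3\<rangle>\<close>, every product with a factor \<open>e\<^sub>2\<close> in
  \<open>\<langle>e\<^sub>3\<rangle>\<close>, and \<open>e\<^sub>3\<close> is central.\<close>
definition flagS :: "'a \<Rightarrow> 'a \<Rightarrow> 'a \<Rightarrow> 'a \<Rightarrow> 'a \<Rightarrow> 'a \<Rightarrow> 'a \<Rightarrow> 'a \<Rightarrow> 'a \<Rightarrow> 'a \<Rightarrow> ('a::comm_ring_1, 4) struct" where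
  "flagS a b c d p q r s u v = (\<lambda>(i, j, k, l).
     let x = axis i 1; y = axis j 1; z = axis k 1 in
     vec4 0 0 (wedge x y 0 1 * (a * z $ 0 + c * z $ 1))
       (wedge x y 0 1 * (b * z $ 0 + d * z $ 1 + p * z $ 2)
        + wedge x y 0 2 * (r * z $ 0 + q * z $ 1 + u * z $ 2)
        + wedge x y 1 2 * ((q - p) * z $ 0 + s * z $ 1 + v * z $ 2)) $ l)"

lemma bracket_flagS:
  "bracket (flagS a b c d p q r s u v) x y z =
     vec4 0 0 (wedge x y 0 1 * (a * z $ 0 + c * z $ 1))
       (wedge x y 0 1 * (b * z $ 0 + d * z $ 1 + p * z $ 2)
        + wedge x y 0 2 * (r * z $ 0 + q * z $ 1 + u * z $ 2)
        + wedge x y 1 2 * ((q - p) * z $ 0 + s * z $ 1 + v * z $ 2))"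
  by (simp add: vec_eq_4 bracket_def sum_4' flagS_def Let_def axis_4 wedge_def) (simp add: algebra_simps)

lemma T47_eq_flagS: "T47 = flagS 1 0 0 0 1 1 0 0 0 0"
proof -
  have "\<forall>i j k l. T47 (i, j, k, l) = (flagS 1 0 0 0 1 1 0 0 0 0 :: ('a, 4) struct) (i, j, k, l)"
    by (simp add: all_4' T47_def flagS_def Let_def axis_4 wedge_def)
  then show ?thesis by auto
qed

lemma T46_eq_flagS: "T46 lam = flagS 0 0 0 0 (- (lam + 1)) (-1) 0 0 0 0"
proof -
  have "\<forall>i j k l. T46 lam (i, j, k, l) = flagS 0 0 0 0 (- (lam + 1)) (-1) 0 0 0 0 (i, j, k, l)"
    by (simp add: all_4' T46_def flagS_def Let_def axis_4 wedge_def)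
  then show ?thesis by auto
qed

lemma bracket_T47:
  "bracket T47 x y z = vec4 0 0 (wedge x y 0 1 * z $ 0) (wedge x y 0 1 * z $ 2 + wedge x y 0 2 * z $ 1)"
  by (simp add: T47_eq_flagS bracket_flagS)

lemma bracket_T46:
  "bracket (T46 lam) x y z = vec4 0 0 0
     (lam * wedge x y 1 2 * z $ 0 - wedge x y 0 2 * z $ 1 - (lam + 1) * wedge x y 0 1 * z $ 2)"
  by (simp add: T46_eq_flagS bracket_flagS algebra_simps)

lemma is_LTS_T47: "is_LTS (T47 :: ('a::comm_ring_1, 4) struct)"
  unfolding is_LTS_def by (simp add: bracket_T47 vec_eq_4 wedge_def algebra_simps)

lemma is_LTS_T46: "is_LTS (T46 lam :: ('a::comm_ring_1, 4) struct)"
  unfolding is_LTS_def by (simp add: bracket_T46 vec_eq_4 wedge_def algebra_simps)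

text \<open>The derivation \<open>[e_0,e_1,.]\<close> sends \<open>e_0\<close> to
  \<open>a e_2\<close> modulo \<open>e_3\<close>, and \<open>e_1\<close>, \<open>e_2\<close> into
  the central line. Applied to the products \<open>[e_0,e_1,e_0]\<close>,
  \<open>[e_0,e_1,e_1]\<close>, \<open>[e_0,e_2,e_0]\<close> and \<open>[e_1,e_2,e_0]\<close>, it
  leaves, up to sign, \<open>a\<close> times \<open>q - p\<close>, \<open>s\<close>,
  \<open>u\<close> and \<open>v\<close>.\<close>

lemma flagS_normal:
  assumes "is_LTS (flagS a b 0 d p q r s u v)" "a \<noteq> (0::'a::field)"
  shows "q = p" "s = 0" "u = 0" "v = 0"
proof -
  let ?B = "bracket (flagS a b 0 d p q r s u v)"
  have L: "?B w w' (?B x y z) = ?B (?B w w' x) y z + ?B x (?B w w' y) z + ?B x y (?B w w' z)"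
    for w w' x y z using assms(1) unfolding is_LTS_def by blast
  have "a * (q - p) = 0"
    using arg_cong[OF L[of "axis 0 1" "axis 1 1" "axis 0 1" "axis 1 1" "axis 0 1"], of "\<lambda>v. v $ 3"]
    by (simp add: bracket_flagS axis_4 wedge_def algebra_simps)
  then show "q = p" using assms(2) by simp
  have "a * s = 0"
    using arg_cong[OF L[of "axis 0 1" "axis 1 1" "axis 0 1" "axis 1 1" "axis 1 1"], of "\<lambda>v. v $ 3"]
    by (simp add: bracket_flagS axis_4 wedge_def algebra_simps)
  then show "s = 0" using assms(2) by simp
  have "a * u = 0"
    using arg_cong[OF L[of "axis 0 1" "axis 1 1" "axis 0 1" "axis 2 1" "axis 0 1"], of "\<lambda>v. v $ 3"]
    by (simp add: bracket_flagS axis_4 wedge_def algebra_simps)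
  then show "u = 0" using assms(2) by simp
  have "a * v = 0"
    using arg_cong[OF L[of "axis 0 1" "axis 1 1" "axis 1 1" "axis 2 1" "axis 0 1"], of "\<lambda>v. v $ 3"]
    by (simp add: bracket_flagS axis_4 wedge_def algebra_simps)
  then show "v = 0" using assms(2) by simp
qed

text \<open>Besides the range of the products, only the first slot is constrained; skew symmetry and
  the cyclic identity carry the conditions to the other two.\<close>

definition flag_adapted :: "('a::comm_ring_1, 4) struct \<Rightarrow> bool" where
  "flag_adapted mu \<longleftrightarrow>
     (\<forall>x y z. bracket mu x y z $ 0 = 0 \<and> bracket mu x y z $ 1 = 0) \<and>
     (\<forall>y z. bracket mu (axis 2 1) y z $ 2 = 0) \<and> (\<forall>y z. bracket mu (axis 3 1) y z = 0)"

lemma flag_adapted_eq_flagS: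
  fixes mu :: "('a::field, 4) struct"
  assumes "(2::'a) \<noteq> 0" and L: "is_LTS mu" and F: "flag_adapted mu"
  shows "mu = flagS (mu (0,1,0,2)) (mu (0,1,0,3)) (mu (0,1,1,2)) (mu (0,1,1,3)) (mu (0,1,2,3))
    (mu (0,2,1,3)) (mu (0,2,0,3)) (mu (1,2,1,3)) (mu (0,2,2,3)) (mu (1,2,2,3))"
proof -
  have A1: "mu (j,i,k,l) = - mu (i,j,k,l)" for i j k l
    using arg_cong[OF L[unfolded is_LTS_def, THEN conjunct1, rule_format,
        of "axis i 1" "axis j 1" "axis k 1"], of "\<lambda>v. v $ l"]
    by (simp add: bracket_axis eq_neg_iff_add_eq_0 add.commute)
  have A2: "mu (i,j,k,l) + mu (j,k,i,l) + mu (k,i,j,l) = 0" for i j k l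
    using arg_cong[OF L[unfolded is_LTS_def, THEN conjunct2, THEN conjunct1, rule_format,
        of "axis i 1" "axis j 1" "axis k 1"], of "\<lambda>v. v $ l"]
    by (simp add: bracket_axis)
  have diag: "mu (i,i,k,l) = 0" for i k l
  proof -
    have "2 * mu (i,i,k,l) = 0" using A1[of i i k l] by (simp add: eq_neg_iff_add_eq_0)
    then show ?thesis using assms(1) by simp
  qed
  have l01: "mu (i,j,k,0) = 0" "mu (i,j,k,1) = 0" for i j k
    using F bracket_axis[of mu i j k] unfolding flag_adapted_def by metis+
  have e3: "mu (3,j,k,l) = 0" for j k l
    using F bracket_axis[of mu 3 j k l] unfolding flag_adapted_def by (metis zero_index)
  have e3': "mu (j,3,k,l) = 0" for j k l using A1[of j 3 k l] e3[of j k l] by simp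
  have e3'': "mu (j,k,3,l) = 0" for j k l using A2[of j k 3 l] e3[of j k l] e3'[of k j l] by simp
  have e2: "mu (2,j,k,2) = 0" for j k
    using F bracket_axis[of mu 2 j k 2] unfolding flag_adapted_def by metis
  have e2': "mu (j,2,k,2) = 0" for j k using A1[of j 2 k 2] e2[of j k] by simp
  have e2'': "mu (j,k,2,2) = 0" for j k using A2[of j k 2 2] e2[of j k] e2'[of k j] by simp
  \<comment> \<open>The cyclic identity determines \<open>[e_1,e_2,e_0]\<close>; this is the origin
    of the coefficient \<open>q - p\<close> in \<open>flagS\<close>.\<close>
  have A2': "mu (1,2,0,3) = mu (0,2,1,3) - mu (0,1,2,3)"
    using A2[of 1 2 0 3] A1[of 2 0 1 3] by (simp add: algebra_simps eq_neg_iff_add_eq_0)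
  have "\<forall>i j k l. mu (i,j,k,l) = flagS (mu (0,1,0,2)) (mu (0,1,0,3)) (mu (0,1,1,2)) (mu (0,1,1,3)) (mu (0,1,2,3))
    (mu (0,2,1,3)) (mu (0,2,0,3)) (mu (1,2,1,3)) (mu (0,2,2,3)) (mu (1,2,2,3)) (i,j,k,l)"
    by (simp add: all_4' flagS_def Let_def axis_4 wedge_def diag l01 e3 e3' e3'' e2 e2' e2'' A2'
        A1[of 1 0] A1[of 2 0] A1[of 2 1])
  then show ?thesis by (intro struct_ext) (elim allE)
qed

section \<open>Classification up to change of basis\<close>

lemma bracket_scaled_struct: "bracket (\<lambda>t. c * mu t) x y z = c *s bracket mu x y z"
  by (simp add: bracket_def vec_eq_iff sum_distrib_left mult_ac)

definition cols :: "'a^4 \<Rightarrow> 'a^4 \<Rightarrow> 'a^4 \<Rightarrow> 'a^4 \<Rightarrow> 'a^4^4" where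
  "cols f0 f1 f2 f3 = (\<chi> i j. if j = 0 then f0 $ i else if j = 1 then f1 $ i else if j = 2 then f2 $ i else f3 $ i)"

lemma cols_vec:
  fixes f0 :: "'a::field^4"
  shows "cols f0 f1 f2 f3 *v x = x $ 0 *s f0 + x $ 1 *s f1 + x $ 2 *s f2 + x $ 3 *s f3"
  by (simp add: vec_eq_iff matrix_vector_4 cols_def mult.commute)

lemma in_span_insert: "x \<in> vec.span (insert a S) \<longleftrightarrow> (\<exists>k. x - k *s a \<in> vec.span S)"
  by (rule vec.span_breakdown_eq)

lemma span_mem_if_relation:
  fixes f x :: "'a::field^'n"
  assumes "c *s f + x = 0" "c \<noteq> 0" "x \<in> vec.span S"
  shows "f \<in> vec.span S"
proof -
  have "c *s f = - x" using assms(1) by (simp add: eq_neg_iff_add_eq_0)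
  then have "inverse c *s (c *s f) = inverse c *s (- x)" by simp
  then have "f = inverse c *s (- x)" using assms(2) by simp
  then show ?thesis using assms(3) by (metis vec.span_neg vec.span_scale)
qed

lemma invertible_cols:
  fixes f0 :: "'a::field^4"
  assumes "f3 \<noteq> 0" "f2 \<notin> vec.span {f3}" "f1 \<notin> vec.span {f2, f3}" "f0 \<notin> vec.span {f1, f2, f3}"
  shows "invertible (cols f0 f1 f2 f3)"
proof -
  have "x = 0" if x: "cols f0 f1 f2 f3 *v x = 0" for x
  proof -
    have eq: "x $ 0 *s f0 + (x $ 1 *s f1 + (x $ 2 *s f2 + x $ 3 *s f3)) = 0"
      using x by (simp add: cols_vec add.assoc)
    have 0: "x $ 0 = 0"
      using span_mem_if_relation[OF eq] assms(4)
      by (meson insertI1 insertI2 vec.span_add vec.span_base vec.span_scale)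
    then have eq1: "x $ 1 *s f1 + (x $ 2 *s f2 + x $ 3 *s f3) = 0" using eq by simp
    have 1: "x $ 1 = 0"
      using span_mem_if_relation[OF eq1] assms(3)
      by (meson insertI1 insertI2 vec.span_add vec.span_base vec.span_scale)
    then have eq2: "x $ 2 *s f2 + x $ 3 *s f3 = 0" using eq1 by simp
    have 2: "x $ 2 = 0"
      using span_mem_if_relation[OF eq2] assms(2)
      by (meson insertI1 vec.span_base vec.span_scale)
    then have "x $ 3 = 0" using eq2 assms(1) by simp
    then show "x = 0" using 0 1 2 by (simp add: vec_eq_4)
  qed
  then have "\<exists>B. B ** cols f0 f1 f2 f3 = mat 1" by (simp add: matrix_left_invertible_ker)
  then show ?thesis by (simp add: invertible_left_inverse)
qed

lemma exists_notin_span_4: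
  assumes "finite S" "card S < 4"
  shows "\<exists>x :: 'a::field^4. x \<notin> vec.span S"
proof (rule ccontr)
  assume "\<not> ?thesis"
  then have "(UNIV :: ('a^4) set) \<subseteq> vec.span S" by auto
  then have "vec.dim (UNIV :: ('a^4) set) \<le> card S" using assms(1) by (rule vec.dim_le_card)
  then show False using assms(2) unfolding vec_dim_card by simp
qed

text \<open>An analogue of Engel's theorem: take \<open>f\<close> outside \<open>W\<close> in the
  last term of the series not contained in \<open>W\<close>; its products lie in the next term,
  which is contained in \<open>W\<close>.\<close>

lemma nilpotent_stable_vector:
  fixes mu :: "('a::field, 'n::finite) struct"
  assumes "nilpotent_LTS mu" "vec.subspace W" "W \<noteq> UNIV"
  shows "\<exists>f. f \<notin> W \<and> (\<forall>x y. bracket mu f x y \<in> W)"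
proof -
  obtain m where m: "lts_series mu m = {0}" using assms(1) unfolding nilpotent_LTS_def by blast
  have "lts_series mu m \<subseteq> W" using m vec.subspace_0[OF assms(2)] by simp
  define k where "k = (LEAST k. lts_series mu k \<subseteq> W)"
  have k: "lts_series mu k \<subseteq> W" unfolding k_def by (rule LeastI) fact
  then have "k \<noteq> 0" using assms(3) by (auto intro: ccontr)
  then obtain k' where k': "k = Suc k'" using not0_implies_Suc by blast
  have "\<not> lts_series mu k' \<subseteq> W" using not_less_Least[of k' "\<lambda>k. lts_series mu k \<subseteq> W"] k' k_def by simp
  then obtain f where f: "f \<in> lts_series mu k'" "f \<notin> W" by blast
  have "bracket mu f x y \<in> W" for x y
  proof -
    have "bracket mu f x y \<in> lts_series mu k" using f(1) unfolding k' by (auto intro: vec.span_base)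
    then show ?thesis using k by blast
  qed
  then show ?thesis using f by blast
qed

lemma subspace_span_neq_UNIV:
  assumes "finite S" "card S < 4"
  shows "vec.subspace (vec.span S :: ('a::field^4) set)" "vec.span S \<noteq> (UNIV :: ('a^4) set)"
  using exists_notin_span_4[OF assms] by auto

lemma is_LTS_skew:
  assumes "is_LTS mu"
  shows "bracket mu y x z = - bracket mu x y z"
  using assms[unfolded is_LTS_def, THEN conjunct1, rule_format, of y x z]
  by (simp add: eq_neg_iff_add_eq_0)

lemma is_LTS_alt:
  assumes "is_LTS (mu :: ('a::field, 'n::finite) struct)" "(2::'a) \<noteq> 0"
  shows "bracket mu x x z = 0"
proof -
  have "bracket mu x x z + bracket mu x x z = 0"
    by (rule assms(1)[unfolded is_LTS_def, THEN conjunct1, rule_format])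
  then have "2 *s bracket mu x x z = 0"
    by (metis one_add_one vec.scale_left_distrib vec.scale_one)
  then show ?thesis using assms(2) by simp
qed

lemma span_1: "y \<in> vec.span {b :: 'a::field^'n} \<longleftrightarrow> (\<exists>l. y = l *s b)"
  by (auto simp: vec.span_singleton)

lemma span_2: "x \<in> vec.span {a, b :: 'a::field^'n} \<longleftrightarrow> (\<exists>k l. x = k *s a + l *s b)"
proof -
  have "(\<exists>l. x - k *s a = l *s b) \<longleftrightarrow> (\<exists>l. x = k *s a + l *s b)" for k
    by (metis add_diff_cancel_left' diff_add_cancel add.commute)
  then show ?thesis by (simp only: in_span_insert[of x a] span_1)
qed

lemma is_LTS_gl_act_inv:
  fixes mu :: "('a::field, 'n::finite) struct"
  assumes "invertible g" "is_LTS mu"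
  obtains nu where "is_LTS nu" "mu = gl_act g nu"
    "\<And>x y z. g *v bracket nu x y z = bracket mu (g *v x) (g *v y) (g *v z)"
proof -
  let ?nu = "gl_act (matrix_inv g) mu"
  have inv: "invertible (matrix_inv g)" "matrix_inv (matrix_inv g) = g"
    using matrix_inv_unique[OF matrix_inv_left[OF assms(1)]] by simp_all
  have eq: "g *v bracket ?nu x y z = bracket mu (g *v x) (g *v y) (g *v z)" for x y z
    by (simp add: bracket_gl_act inv(2) matrix_inv_vec assms(1))
  show ?thesis
    by (rule that[of ?nu]) (auto simp: eq is_LTS_gl_act assms inv gl_act_eqI)
qed

text \<open>The flag grows from the bottom: stable vectors relative to \<open>0\<close>,
  \<open><f3>\<close> and \<open><f2,f3>\<close> give \<open>f3\<close>, \<open>f2\<close> and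
  \<open>f1\<close>, and \<open>f0\<close> is any vector completing the basis.\<close>

lemma nilpotent_LTS_flag:
  fixes mu :: "('a::field, 4) struct"
  assumes "(2::'a) \<noteq> 0" and nil: "nilpotent_LTS mu"
  obtains g nu where "invertible g" "mu = gl_act g nu" "is_LTS nu" "flag_adapted nu"
proof -
  have L: "is_LTS mu" using nil unfolding nilpotent_LTS_def by blast
  have "vec.subspace {0 :: 'a^4}" "{0 :: 'a^4} \<noteq> UNIV"
    using subspace_span_neq_UNIV[of "{} :: ('a^4) set"] by simp_all
  then obtain f3 where f3: "f3 \<noteq> 0" "\<And>x y. bracket mu f3 x y = 0"
    using nilpotent_stable_vector[OF nil, of "{0}"] by auto
  have "card {f3} < 4" by simp
  then obtain f2 where f2: "f2 \<notin> vec.span {f3}" "\<And>x y. bracket mu f2 x y \<in> vec.span {f3}"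
    using nilpotent_stable_vector[OF nil subspace_span_neq_UNIV[of "{f3}"]] by auto
  have "card {f2, f3} < 4" by (rule le_less_trans[OF card_insert_le_m1]) auto
  then obtain f1 where f1: "f1 \<notin> vec.span {f2, f3}" "\<And>x y. bracket mu f1 x y \<in> vec.span {f2, f3}"
    using nilpotent_stable_vector[OF nil subspace_span_neq_UNIV[of "{f2, f3}"]] by auto
  have "card {f1, f2, f3} < 4" by (simp add: card_insert_if)
  then obtain f0 where f0: "f0 \<notin> vec.span {f1, f2, f3}"
    using exists_notin_span_4[of "{f1, f2, f3}"] by auto
  let ?g = "cols f0 f1 f2 f3"
  have g: "invertible ?g" by (rule invertible_cols) fact+
  obtain nu where nu: "is_LTS nu" "mu = gl_act ?g nu"
    "\<And>x y z. ?g *v bracket nu x y z = bracket mu (?g *v x) (?g *v y) (?g *v z)"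
    using is_LTS_gl_act_inv[OF g L] by blast
  have inj: "v = w" if "?g *v v = ?g *v w" for v w
    using matrix_inv_vec(1)[OF g] that by metis
  have ax: "?g *v axis 1 1 = f1" "?g *v axis 2 1 = f2" "?g *v axis 3 1 = f3"
    by (simp_all add: cols_vec axis_4)
  have gv: "?g *v vec4 0 0 k l = k *s f2 + l *s f3" for k l by (simp add: cols_vec)
  have b3: "bracket nu (axis 3 1) y z = 0" for y z
    by (rule inj) (simp add: nu(3) ax f3)
  have b2: "bracket nu (axis 2 1) y z $ l = 0" if "l = 0 \<or> l = 1 \<or> l = 2" for y z l
  proof -
    obtain k where "bracket mu f2 (?g *v y) (?g *v z) = k *s f3"
      using f2(2)[unfolded span_1] by blast
    then have "bracket nu (axis 2 1) y z = vec4 0 0 0 k"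
      by - (rule inj, simp add: nu(3) ax gv)
    then show ?thesis using that by auto
  qed
  have b1: "bracket nu (axis 1 1) y z $ l = 0" if "l = 0 \<or> l = 1" for y z l
  proof -
    obtain k k' where "bracket mu f1 (?g *v y) (?g *v z) = k *s f2 + k' *s f3"
      using f1(2)[unfolded span_2] by blast
    then have "bracket nu (axis 1 1) y z = vec4 0 0 k k'"
      by - (rule inj, simp add: nu(3) ax gv)
    then show ?thesis using that by auto
  qed
  have dec: "x = x $ 0 *s axis 0 1 + x $ 1 *s axis 1 1 + x $ 2 *s axis 2 1 + x $ 3 *s axis 3 1" for x :: "'a^4"
    by (simp add: vec_eq_4 axis_4)
  \<comment> \<open>Nothing was imposed on \<open>f0\<close>: its products come from the other basis
    vectors by skew symmetry, and \<open>[e_0,e_0,z]\<close> vanishes since 2 is nonzero.\<close>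
  have b0: "bracket nu (axis 0 1) y z $ l = 0" if l: "l = 0 \<or> l = 1" for y z l
  proof -
    note skew = is_LTS_skew[OF nu(1)]
    have "bracket nu (axis i 1) (axis 0 1) z $ l = 0" if "i = 1 \<or> i = 2 \<or> i = 3" for i
      using b1[OF l] b2[of l] b3 l that by auto
    then have "bracket nu (axis 0 1) (axis i 1) z $ l = 0" if "i = 1 \<or> i = 2 \<or> i = 3" for i
      using that by (subst skew) simp
    then show ?thesis
      by (subst dec[of y]) (simp add: bracket_add bracket_scale is_LTS_alt[OF nu(1) assms(1)])
  qed
  have "flag_adapted nu"
    unfolding flag_adapted_def
  proof (intro conjI allI)
    fix x y z
    show "bracket nu x y z $ 0 = 0" "bracket nu x y z $ 1 = 0"
      by (subst dec[of x], simp add: bracket_add bracket_scale b0 b1 b2 b3)+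
  qed (simp_all add: b2 b3)
  then show ?thesis using that g nu by blast
qed

text \<open>The part of \<open>[e\<^sub>0, e\<^sub>1, \<cdot>]\<close> modulo \<open>e\<^sub>3\<close> is a linear functional with values in \<open>\<langle>e\<^sub>2\<rangle>\<close>; the new \<open>e\<^sub>1\<close>
  spans its kernel.\<close>
lemma flag_adapted_case_nonzero:
  fixes nu :: "('a::field, 4) struct"
  assumes two: "(2::'a) \<noteq> 0" and L: "is_LTS nu" and F: "flag_adapted nu"
    and ne: "nu (0,1,0,2) \<noteq> 0 \<or> nu (0,1,1,2) \<noteq> 0"
  obtains g a b d p r where "invertible g" "a \<noteq> 0" "nu = gl_act g (flagS a b 0 d p p r 0 0 0)"
proof -
  obtain a b c d p q r s u v where nu: "nu = flagS a b c d p q r s u v"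
    and a: "a = nu (0,1,0,2)" and c: "c = nu (0,1,1,2)"
    using flag_adapted_eq_flagS[OF two L F] by blast
  \<comment> \<open>The new \<open>e_0\<close> is an old basis vector off the kernel of
    \<open>z \<mapsto> a * z $ 0 + c * z $ 1\<close>, and \<open>(- c, a)\<close> spans that kernel.
    \<open>\<Delta>\<close> is both the value of the functional at the new \<open>e_0\<close> and
    the determinant of the change of basis.\<close>
  define \<alpha> \<beta> where "\<alpha> = (if a \<noteq> 0 then 1 else 0 :: 'a)" and "\<beta> = (if a \<noteq> 0 then 0 else 1 :: 'a)"
  define \<Delta> where "\<Delta> = \<alpha> * a + \<beta> * c"
  have \<Delta>: "\<Delta> \<noteq> 0" using ne unfolding \<Delta>_def \<alpha>_def \<beta>_def a c by auto
  define g where "g = cols (vec4 \<alpha> \<beta> 0 0) (vec4 (- c) a 0 0) (vec4 0 0 1 0) (vec4 0 0 0 (1::'a))"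
  define h where "h = cols (vec4 (a / \<Delta>) (- \<beta> / \<Delta>) 0 0) (vec4 (c / \<Delta>) (\<alpha> / \<Delta>) 0 0) (vec4 0 0 1 0) (vec4 0 0 0 (1::'a))"
  have "g ** h = mat 1"
  proof -
    have "g *v (h *v x) = x" for x
      using \<Delta> by (simp add: g_def h_def cols_vec vec_eq_4 \<Delta>_def divide_simps) (simp add: algebra_simps)
    then show ?thesis by (simp add: matrix_eq matrix_vector_mul_assoc[symmetric])
  qed
  then have g: "invertible g" by (rule matrix_inv_unique)
  obtain nu' where nu': "is_LTS nu'" "nu = gl_act g nu'"
    "\<And>x y z. g *v bracket nu' x y z = bracket nu (g *v x) (g *v y) (g *v z)"
    using is_LTS_gl_act_inv[OF g L] by blast
  have inj: "v = w" if "g *v v = g *v w" for v w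
    using matrix_inv_vec(1)[OF g] that by metis
  \<comment> \<open>Products lie in \<open><e_2,e_3>\<close>, which \<open>g\<close> fixes
    pointwise, so the outer \<open>g\<close> cancels.\<close>
  have br: "bracket nu' x y z = bracket (flagS a b c d p q r s u v) (g *v x) (g *v y) (g *v z)" for x y z
    by (rule inj) (simp add: nu'(3) nu, simp add: g_def cols_vec vec_eq_4 bracket_flagS)
  have "flag_adapted nu'"
    unfolding flag_adapted_def br by (simp add: bracket_flagS g_def cols_vec axis_4 wedge_def vec_eq_4)
  then obtain a' b' c' d' p' q' r' s' u' v' where nu'_eq: "nu' = flagS a' b' c' d' p' q' r' s' u' v'"
    and a': "a' = nu' (0,1,0,2)" and c': "c' = nu' (0,1,1,2)"
    using flag_adapted_eq_flagS[OF two nu'(1)] by blast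
  \<comment> \<open>One factor comes from \<open>wedge\<close>, the other from the
    functional.\<close>
  have "a' = \<Delta> * \<Delta>"
    unfolding a' bracket_axis[of nu', symmetric] br
    by (simp add: bracket_flagS g_def cols_vec axis_4 wedge_def \<Delta>_def algebra_simps)
  then have a'0: "a' \<noteq> 0" using \<Delta> by simp
  have c'0: "c' = 0"
    unfolding c' bracket_axis[of nu', symmetric] br
    by (simp add: bracket_flagS g_def cols_vec axis_4 wedge_def algebra_simps)
  have "nu' = flagS a' b' 0 d' p' p' r' 0 0 0"
    using nu'(1) flagS_normal[of a' b' d' p' q' r' s' u' v'] a'0 unfolding nu'_eq c'0 by simp
  then show ?thesis using that g a'0 nu'(2) by blast
qed

text \<open>\<open>P\<close> is the characteristic polynomial written out, with \<open>e2\<close>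
  the sum of the principal minors of order two.\<close>

lemma eigenvector_3:
  fixes A :: "'a::alg_closed_field^3^3"
  shows "\<exists>t x. x \<noteq> 0 \<and> A *v x = t *s x"
proof -
  define e2 where "e2 = A$1$1 * A$2$2 - A$1$2 * A$2$1 + A$1$1 * A$3$3 - A$1$3 * A$3$1 + A$2$2 * A$3$3 - A$2$3 * A$3$2"
  define P where "P = [: - det A, e2, - (A$1$1 + A$2$2 + A$3$3), 1 :]"
  have "degree P > 0" by (simp add: P_def)
  then obtain t where t: "poly P t = 0" using alg_closed_imp_poly_has_root by blast
  define B where "B = (\<chi> i j. A $ i $ j - (if i = j then t else 0))"
  have "det B = - poly P t"
    by (simp add: det_3 B_def P_def e2_def algebra_simps)
  then have "\<not> invertible B" using t by (simp add: invertible_det_nz)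
  then obtain x where x: "x \<noteq> 0" "B *v x = 0"
    using matrix_left_invertible_ker[of B] by (auto simp: invertible_left_inverse)
  have "A *v x = B *v x + t *s x"
    by (simp add: vec_eq_iff matrix_vector_mult_def B_def left_diff_distrib sum_subtractf
        if_distrib[of "\<lambda>c. c * _"] cong: if_cong)
  then show ?thesis using x by auto
qed

text \<open>An eigenvector of the representing matrix gives \<open>f2\<close> with
  \<open>[f2,y,f2] = 0\<close>, which clears \<open>u\<close> and \<open>v\<close>. A zero of the
  quadratic form \<open>[f2,z,z]\<close> outside \<open><f2,e3>\<close> gives \<open>f1\<close> and
  clears \<open>s\<close>. The matrix is then lower triangular.\<close>

lemma flag_adapted_case_zero:
  fixes nu :: "('a::alg_closed_field, 4) struct"
  assumes two: "(2::'a) \<noteq> 0" and L: "is_LTS nu" and F: "flag_adapted nu"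
    and z: "nu (0,1,0,2) = 0" "nu (0,1,1,2) = 0"
  obtains g b d p q r where "invertible g" "nu = gl_act g (flagS 0 b 0 d p q r 0 0 0)"
proof -
  obtain b d p q r s u v where nu: "nu = flagS 0 b 0 d p q r s u v"
    using flag_adapted_eq_flagS[OF two L F] unfolding z by blast
  \<comment> \<open>Rows are paired with the cross product
    \<open>(wedge x y 1 2, - wedge x y 0 2, wedge x y 0 1)\<close>; the zero trace reflects the
    cyclic identity.\<close>
  define A where "A = (vector [vector [q - p, s, v], vector [- r, - q, - u], vector [b, d, p]] :: 'a^3^3)"
  obtain t w where w: "w \<noteq> 0" "A *v w = t *s w" using eigenvector_3[of A] by blast
  define f2 where "f2 = vec4 (w $ 1) (w $ 2) (w $ 3) 0"
  define e3 where "e3 = vec4 0 0 0 (1::'a)"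
  have eig: "(q - p) * w $ 1 + s * w $ 2 + v * w $ 3 = t * w $ 1"
    "- r * w $ 1 - q * w $ 2 - u * w $ 3 = t * w $ 2" "b * w $ 1 + d * w $ 2 + p * w $ 3 = t * w $ 3"
    using w(2) by (simp_all add: vec_eq_iff matrix_vector_mult_def sum_3 forall_3 A_def)
  have w0: "w $ 1 \<noteq> 0 \<or> w $ 2 \<noteq> 0 \<or> w $ 3 \<noteq> 0" using w(1) by (simp add: vec_eq_iff forall_3)
  \<comment> \<open>Since \<open>A w = t w\<close>, this is \<open>t\<close> times the dot product
    of a cross product with one of its factors.\<close>
  have B3: "bracket nu f2 y f2 = 0" for y
  proof -
    have "wedge f2 y 0 1 * (t * w $ 3) + wedge f2 y 0 2 * (- (t * w $ 2)) + wedge f2 y 1 2 * (t * w $ 1) = 0"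
      by (simp add: wedge_def f2_def algebra_simps)
    then show ?thesis
      unfolding eig[symmetric] by (simp add: nu bracket_flagS vec_eq_4 f2_def algebra_simps)
  qed
  have e3_0: "e3 \<noteq> 0" by (simp add: e3_def vec_eq_4)
  have f2: "f2 \<notin> vec.span {e3}" using w0 by (auto simp: span_1 f2_def e3_def vec_eq_4)
  have "card {f2, e3} < 4" by (simp add: card_insert_if)
  then obtain h where h: "h \<notin> vec.span {f2, e3}" using exists_notin_span_4[of "{f2, e3}"] by auto
  have "card {h, f2, e3} < 4" by (simp add: card_insert_if)
  then obtain k where k: "k \<notin> vec.span {h, f2, e3}" using exists_notin_span_4[of "{h, f2, e3}"] by auto
  have Bform: "bracket nu x y z = vec4 0 0 0 (bracket nu x y z $ 3)" for x y z
    by (simp add: nu bracket_flagS)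
  have "\<exists>f1. f1 \<notin> vec.span {f2, e3} \<and> bracket nu f2 f1 f1 = 0"
  proof (cases "bracket nu f2 h h $ 3 = 0")
    case True
    then show ?thesis using h Bform[of f2 h h] by (auto simp: vec_eq_4)
  next
    case False
    \<comment> \<open>The quadratic form \<open>[f2,z,z]\<close> restricted to
      \<open>z = k + c h\<close>, as a polynomial in \<open>c\<close>; its leading coefficient is
      nonzero in this case.\<close>
    let ?P = "[: bracket nu f2 k k $ 3, bracket nu f2 k h $ 3 + bracket nu f2 h k $ 3, bracket nu f2 h h $ 3 :]"
    have "degree ?P > 0" using False by simp
    then obtain c where c: "poly ?P c = 0" using alg_closed_imp_poly_has_root by blast
    have "bracket nu f2 (k + c *s h) (k + c *s h) $ 3 = 0"
      using c by (simp add: bracket_add bracket_scale algebra_simps)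
    then have "bracket nu f2 (k + c *s h) (k + c *s h) = 0"
      using Bform[of f2 "k + c *s h" "k + c *s h"] by (simp add: vec_eq_4)
    moreover have "k + c *s h \<notin> vec.span {f2, e3}"
    proof
      assume "k + c *s h \<in> vec.span {f2, e3}"
      then have "k - (- c) *s h \<in> vec.span {f2, e3}" by (simp add: vec.scale_minus_left)
      then have "k \<in> vec.span {h, f2, e3}" unfolding in_span_insert[of k h] by blast
      then show False using k by simp
    qed
    ultimately show ?thesis by blast
  qed
  then obtain f1 where f1: "f1 \<notin> vec.span {f2, e3}" "bracket nu f2 f1 f1 = 0" by blast
  have "card {f1, f2, e3} < 4" by (simp add: card_insert_if)
  then obtain f0 where f0: "f0 \<notin> vec.span {f1, f2, e3}" using exists_notin_span_4[of "{f1, f2, e3}"] by auto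
  let ?g = "cols f0 f1 f2 e3"
  have g: "invertible ?g" by (rule invertible_cols) fact+
  obtain nu' where nu': "is_LTS nu'" "nu = gl_act ?g nu'"
    "\<And>x y z. ?g *v bracket nu' x y z = bracket nu (?g *v x) (?g *v y) (?g *v z)"
    using is_LTS_gl_act_inv[OF g L] by blast
  have inj: "x = y" if "?g *v x = ?g *v y" for x y
    using matrix_inv_vec(1)[OF g] that by metis
  have ge3: "?g *v vec4 0 0 0 k = vec4 0 0 0 k" for k by (simp add: cols_vec e3_def vec_eq_4)
  have br: "bracket nu' x y z = bracket nu (?g *v x) (?g *v y) (?g *v z)" for x y z
  proof (rule inj)
    obtain k where k: "bracket nu (?g *v x) (?g *v y) (?g *v z) = vec4 0 0 0 k" using Bform by blast
    show "?g *v bracket nu' x y z = ?g *v bracket nu (?g *v x) (?g *v y) (?g *v z)"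
      by (simp only: nu'(3) k ge3)
  qed
  have B0: "bracket nu x y z $ 0 = 0" "bracket nu x y z $ 1 = 0" "bracket nu x y z $ 2 = 0" for x y z
    by (simp_all add: nu bracket_flagS)
  have Be3: "bracket nu e3 y z = 0" for y z
    by (simp add: nu bracket_flagS e3_def wedge_def vec_eq_4)
  have ax: "?g *v axis 0 1 = f0" "?g *v axis 1 1 = f1" "?g *v axis 2 1 = f2" "?g *v axis 3 1 = e3"
    by (simp_all add: cols_vec axis_4)
  have "flag_adapted nu'"
    unfolding flag_adapted_def br ax
    by (simp add: B0 Be3)
  then have eq: "nu' = flagS (nu' (0,1,0,2)) (nu' (0,1,0,3)) (nu' (0,1,1,2)) (nu' (0,1,1,3)) (nu' (0,1,2,3))
    (nu' (0,2,1,3)) (nu' (0,2,0,3)) (nu' (1,2,1,3)) (nu' (0,2,2,3)) (nu' (1,2,2,3))"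
    by (rule flag_adapted_eq_flagS[OF two nu'(1)])
  have skew: "bracket nu x y z = - bracket nu y x z" for x y z by (rule is_LTS_skew[OF L])
  have "nu' (0,1,0,2) = 0" "nu' (0,1,1,2) = 0"
    unfolding bracket_axis[of nu', symmetric] br by (rule B0)+
  moreover have "nu' (1,2,1,3) = 0" "nu' (0,2,2,3) = 0" "nu' (1,2,2,3) = 0"
    unfolding bracket_axis[of nu', symmetric] br ax skew[of _ f2] by (simp_all add: B3 f1)
  ultimately show ?thesis using that[OF g] nu'(2) eq by metis
qed

theorem nilpotent_LTS_4_classification:
  fixes mu :: "('a::alg_closed_field, 4) struct"
  assumes two: "(2::'a) \<noteq> 0" and nil: "nilpotent_LTS mu"
  obtains (rank2) g a b d p r where "invertible g" "a \<noteq> 0" "mu = gl_act g (flagS a b 0 d p p r 0 0 0)"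
  | (rank1) g b d p q r where "invertible g" "mu = gl_act g (flagS 0 b 0 d p q r 0 0 0)"
proof -
  obtain g nu where g: "invertible g" "mu = gl_act g nu" and nu: "is_LTS nu" "flag_adapted nu"
    using nilpotent_LTS_flag[OF two nil] by blast
  show ?thesis
  proof (cases "nu (0,1,0,2) \<noteq> 0 \<or> nu (0,1,1,2) \<noteq> 0")
    case True
    then obtain h a b d p r where h: "invertible h" "a \<noteq> 0" "nu = gl_act h (flagS a b 0 d p p r 0 0 0)"
      using flag_adapted_case_nonzero[OF two nu] by blast
    show ?thesis
      by (rule rank2[of "g ** h" a b d p r]) (use g h in \<open>simp_all add: gl_act_mult invertible_mult\<close>)
  next
    case False
    then obtain h b d p q r where h: "invertible h" "nu = gl_act h (flagS 0 b 0 d p q r 0 0 0)"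
      using flag_adapted_case_zero[OF two nu] by blast
    show ?thesis
      by (rule rank1[of "g ** h" b d p q r]) (use g h in \<open>simp_all add: gl_act_mult invertible_mult\<close>)
  qed
qed

section \<open>Generic members of the two normal forms\<close>

lemma invertible_if_ker:
  fixes g :: "'a::field^'n^'n"
  shows "(\<And>x. g *v x = 0 \<Longrightarrow> x = 0) \<Longrightarrow> invertible g"
  by (simp add: invertible_left_inverse matrix_left_invertible_ker)

text \<open>Put \<open>f0 = e_0 + \<alpha> e_1\<close> and \<open>f1 = e_1 + \<beta> e_2\<close>.
  The choice of \<open>\<alpha>\<close> makes \<open>[f0,e_2,f0]\<close> vanish, that of
  \<open>\<beta>\<close> makes \<open>[f0,f1,f1]\<close> vanish, and the remaining columns are
  forced to be \<open>[f0,f1,f0]\<close> and its image under \<open>[f0,f1,.]\<close>.\<close>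

lemma flagS_in_orbit_T47:
  fixes a :: "'a::field"
  assumes "(2::'a) \<noteq> 0" "a \<noteq> 0" "p \<noteq> 0"
  shows "flagS a b 0 d p p r 0 0 0 \<in> orbit T47"
proof -
  define \<alpha> \<beta> where "\<alpha> = - r / p" and "\<beta> = - d / (2 * p)"
  have r: "r = - (\<alpha> * p)" and d: "d = - (2 * \<beta> * p)" using assms by (simp_all add: \<alpha>_def \<beta>_def)
  define g where "g = cols (vec4 1 \<alpha> 0 0) (vec4 0 1 \<beta> 0) (vec4 0 0 a (b + \<alpha> * d)) (vec4 0 0 0 (a * p))"
  have g: "invertible g"
    by (rule invertible_if_ker) (use assms in \<open>auto simp: g_def cols_vec vec_eq_4\<close>)
  have "gl_act g T47 = flagS a b 0 d p p r 0 0 0"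
    by (rule gl_act_eqI[OF g])
       (simp add: g_def cols_vec vec_eq_4 bracket_T47 bracket_flagS wedge_def r d algebra_simps)
  then show ?thesis using g unfolding orbit_def by (auto intro!: exI[of _ g])
qed

text \<open>The triangular matrix has eigenvalues \<open>q - p\<close>, \<open>- q\<close>,
  \<open>p\<close>; the last three hypotheses say that they are distinct. \<open>x\<close>,
  \<open>y\<close>, \<open>z\<close> are the entries of its eigenvectors. The eigenvalues are
  \<open>- q\<close> times \<open>l\<close>, \<open>1\<close>, \<open>- (l + 1)\<close>, which are
  those of \<open>T46 l\<close>.\<close>

lemma flagS_in_orbit_T46:
  fixes q :: "'a::field"
  assumes "q \<noteq> 0" "q + p \<noteq> 0" "2 * q - p \<noteq> 0" "q - 2 * p \<noteq> 0"
  shows "flagS 0 b 0 d p q r 0 0 0 \<in> orbit (T46 ((p - q) / q))"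
proof -
  define l where "l = (p - q) / q"
  have p: "p = q + q * l" using assms(1) by (simp add: l_def field_simps)
  define y where "y = - d / (q + p)"
  define x where "x = - r / (2 * q - p)"
  define z where "z = (b + d * x) / (q - 2 * p)"
  have d: "d = - ((q + p) * y)" using assms by (simp add: y_def)
  have r: "r = - ((2 * q - p) * x)" using assms by (simp add: x_def)
  have "(q - 2 * p) * z = b + d * x" using assms by (simp add: z_def)
  then have b: "b = (q - 2 * p) * z - d * x" by simp
  define g where "g = cols (vec4 1 x z 0) (vec4 0 1 y 0) (vec4 0 0 1 0) (vec4 0 0 0 (- q))"
  have g: "invertible g"
    by (rule invertible_if_ker) (use assms in \<open>auto simp: g_def cols_vec vec_eq_4\<close>)
  have "gl_act g (T46 l) = flagS 0 b 0 d p q r 0 0 0"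
    by (rule gl_act_eqI[OF g])
       (simp add: g_def cols_vec vec_eq_4 bracket_T46 bracket_flagS wedge_def b r d p algebra_simps)
  then show ?thesis using g unfolding orbit_def l_def by (auto intro!: exI[of _ g])
qed

lemma polyfun_flagS:
  assumes "a \<in> polyfun" "b \<in> polyfun" "c \<in> polyfun" "d \<in> polyfun" "p \<in> polyfun" "q \<in> polyfun"
    "r \<in> polyfun" "s \<in> polyfun" "u \<in> polyfun" "v \<in> polyfun"
  shows "(\<lambda>x. flagS (a x) (b x) (c x) (d x) (p x) (q x) (r x) (s x) (u x) (v x) t) \<in> polyfun"
proof -
  obtain i j k l where t: "t = (i, j, k, l)" by (metis prod.exhaust)
  have "l = 0 \<or> l = 1 \<or> l = 2 \<or> l = 3" using UNIV_4' by auto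
  then show ?thesis
    unfolding t flagS_def Let_def
    by (elim disjE; simp) (intro polyfun_intros assms)+
qed

lemma flagS_in_closure_T47:
  fixes a :: "'a::alg_closed_field"
  assumes two: "(2::'a) \<noteq> 0"
  shows "flagS a b 0 d p p r 0 0 0 \<in> zariski_closure (orbit T47)"
proof (rule zariski_closureI)
  fix f :: "('a, 4) struct \<Rightarrow> 'a" assume f: "f \<in> polyfun" "\<And>mu. mu \<in> orbit T47 \<Longrightarrow> f mu = 0"
  define \<theta> where "\<theta> x = flagS (x 0) (x 1) 0 (x 2) (x 3) (x 3) (x 4) 0 0 0" for x :: "nat \<Rightarrow> 'a"
  have \<theta>: "(\<lambda>x. \<theta> x t) \<in> polyfun" for t
    unfolding \<theta>_def by (intro polyfun_flagS pf_var pf_const)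
  have "f (\<theta> x) = 0" for x
  proof (rule polyfun_eq_0_if_mult[OF infinite_UNIV_alg_closed, of "\<lambda>x. x 0 * x 3" "\<lambda>x. f (\<theta> x)" "\<lambda>_. 1"])
    show "(\<lambda>x. x 0 * x 3) \<in> polyfun" by (intro pf_mult pf_var)
    show "(\<lambda>x. f (\<theta> x)) \<in> polyfun" by (rule polyfun_compose[OF f(1) \<theta>])
    show "f (\<theta> x) = 0" if "x 0 * x 3 \<noteq> 0" for x
      using that unfolding \<theta>_def by (intro f(2) flagS_in_orbit_T47[OF two]) auto
  qed auto
  from this[of "(\<lambda>i. 0)(0 := a, 1 := b, 2 := d, 3 := p, 4 := r)"]
  show "f (flagS a b 0 d p p r 0 0 0) = 0" by (simp add: \<theta>_def)
qed

lemma flagS_in_closure_T46: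
  fixes p :: "'a::alg_closed_field"
  assumes two: "(2::'a) \<noteq> 0"
  shows "flagS 0 b 0 d p q r 0 0 0 \<in> zariski_closure (\<Union>lam. orbit (T46 lam))"
proof (rule zariski_closureI)
  fix f :: "('a, 4) struct \<Rightarrow> 'a" assume f: "f \<in> polyfun" "\<And>mu. mu \<in> (\<Union>lam. orbit (T46 lam)) \<Longrightarrow> f mu = 0"
  define \<theta> where "\<theta> x = flagS 0 (x 0) 0 (x 1) (x 2) (x 3) (x 4) 0 0 0" for x :: "nat \<Rightarrow> 'a"
  have \<theta>: "(\<lambda>x. \<theta> x t) \<in> polyfun" for t
    unfolding \<theta>_def by (intro polyfun_flagS pf_var pf_const)
  define \<delta> where "\<delta> x = x 3 * (x 3 + x 2) * (2 * x 3 - x 2) * (x 3 - 2 * x 2)" for x :: "nat \<Rightarrow> 'a"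
  \<comment> \<open>The point with \<open>q = 1\<close> and all other parameters zero gives
    \<open>\<delta>\<close> the value 2.\<close>
  have "f (\<theta> x) = 0" for x
  proof (rule polyfun_eq_0_if_mult[OF infinite_UNIV_alg_closed, of \<delta> "\<lambda>x. f (\<theta> x)" "\<lambda>i. if i = 3 then 1 else 0"])
    show "\<delta> \<in> polyfun" unfolding \<delta>_def[abs_def] by (intro pf_mult pf_add polyfun_diff pf_var pf_const)
    show "(\<lambda>x. f (\<theta> x)) \<in> polyfun" by (rule polyfun_compose[OF f(1) \<theta>])
    show "f (\<theta> x) = 0" if "\<delta> x \<noteq> 0" for x
    proof -
      have "\<theta> x \<in> orbit (T46 ((x 2 - x 3) / x 3))"
        unfolding \<theta>_def by (rule flagS_in_orbit_T46) (use that in \<open>auto simp: \<delta>_def\<close>)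
      then show ?thesis by (intro f(2)) blast
    qed
  qed (use two in \<open>simp add: \<delta>_def\<close>)
  from this[of "(\<lambda>i. 0)(0 := b, 1 := d, 2 := p, 3 := q, 4 := r)"]
  show "f (flagS 0 b 0 d p q r 0 0 0) = 0" by (simp add: \<theta>_def)
qed

section \<open>Closed conditions and the two components\<close>

lemma zariski_closed_vec_eq_0:
  assumes "\<And>i. (\<lambda>x. F x $ i) \<in> polyfun"
  shows "zariski_closed {x. F x = (0 :: 'a::comm_ring_1^'n)}"
proof -
  have "zariski_closed {x. \<forall>i. F x $ i = 0}"
    by (intro zariski_closed_Collect_all zariski_closed_polyfun assms)
  then show ?thesis by (simp add: vec_eq_iff)
qed

lemma zariski_closed_is_LTS: "zariski_closed {mu :: ('a::comm_ring_1, 'n::finite) struct. is_LTS mu}"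
proof -
  have b: "(\<lambda>mu :: ('a, 'n) struct. bracket mu (f mu) (g mu) (h mu) $ l) \<in> polyfun"
    if "\<And>i. (\<lambda>mu. f mu $ i) \<in> polyfun" "\<And>i. (\<lambda>mu. g mu $ i) \<in> polyfun"
      "\<And>i. (\<lambda>mu. h mu $ i) \<in> polyfun" for f g h l
    by (intro polyfun_bracket pf_var that)
  have c: "(\<lambda>mu :: ('a, 'n) struct. bracket mu x y z $ l) \<in> polyfun" for x y z l
    by (intro b pf_const)
  have "zariski_closed {mu :: ('a, 'n) struct.
     (\<forall>x y z. bracket mu x y z + bracket mu y x z = 0) \<and>
     (\<forall>x y z. bracket mu x y z + bracket mu y z x + bracket mu z x y = 0) \<and>
     (\<forall>u v x y z. bracket mu u v (bracket mu x y z) -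
         (bracket mu (bracket mu u v x) y z + bracket mu x (bracket mu u v y) z
         + bracket mu x y (bracket mu u v z)) = 0)}"
    by (intro zariski_closed_Collect_conj zariski_closed_Collect_all zariski_closed_vec_eq_0)
       (simp_all, (intro pf_add polyfun_diff b c pf_const)+)
  then show ?thesis unfolding is_LTS_def right_minus_eq .
qed

text \<open>A closed and invariant substitute for nilpotency: the identity forces
  \<open>lts_series mu 3 = {0}\<close>, and it passes to closures.\<close>

definition LTS_class_3 :: "('a::field, 'n::finite) struct set" where
  "LTS_class_3 = {mu. is_LTS mu \<and>
     (\<forall>a b c d e x y. bracket mu (bracket mu (bracket mu a b c) d e) x y = 0)}"

lemma zariski_closed_LTS_class_3: "zariski_closed (LTS_class_3 :: ('a::field, 'n::finite) struct set)"
  unfolding LTS_class_3_def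
  by (intro zariski_closed_Collect_conj zariski_closed_Collect_all zariski_closed_vec_eq_0
      zariski_closed_is_LTS polyfun_bracket pf_var pf_const)

lemma LTS_class_3_subset: "LTS_class_3 \<subseteq> (LTS_variety :: ('a::field, 'n::finite) struct set)"
proof
  fix mu :: "('a, 'n) struct" assume "mu \<in> LTS_class_3"
  then have L: "is_LTS mu"
    and 0: "bracket mu (bracket mu (bracket mu a b c) d e) x y = 0" for a b c d e x y
    unfolding LTS_class_3_def by auto
  define W1 where "W1 = {v. \<forall>d e x y. bracket mu (bracket mu v d e) x y = 0}"
  define W2 where "W2 = {v. \<forall>x y. bracket mu v x y = 0}"
  have W1: "vec.subspace W1" and W2: "vec.subspace W2"
    unfolding vec.subspace_def W1_def W2_def
    by (simp_all add: bracket_zero bracket_add bracket_scale)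
  have s1: "lts_series mu 1 \<subseteq> W1"
    by (simp, rule vec.span_minimal[OF _ W1]) (auto simp: W1_def 0)
  have s2: "lts_series mu 2 \<subseteq> W2"
    unfolding numeral_2_eq_2 lts_series.simps(2)[of mu "Suc 0"]
    by (rule vec.span_minimal[OF _ W2]) (use s1 in \<open>auto simp: W1_def W2_def\<close>)
  have "{bracket mu a b c |a b c. a \<in> lts_series mu 2} \<subseteq> {0}"
    using s2 by (auto simp: W2_def)
  then have "lts_series mu (Suc 2) \<subseteq> {0}"
    unfolding lts_series.simps(2) using vec.span_minimal[OF _ vec.subspace_single_0] by blast
  moreover have "0 \<in> lts_series mu (Suc 2)" unfolding lts_series.simps(2) by (rule vec.span_zero)
  ultimately have "lts_series mu (Suc 2) = {0}" by blast
  then show "mu \<in> LTS_variety" using L unfolding LTS_variety_def nilpotent_LTS_def by blast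
qed

lemma LTS_class_3_gl_act:
  assumes "mu \<in> LTS_class_3" "invertible g"
  shows "gl_act g mu \<in> LTS_class_3"
  using assms unfolding LTS_class_3_def by (simp add: is_LTS_gl_act bracket_gl_act matrix_inv_vec)

lemma T47_class_3: "(T47 :: ('a::field, 4) struct) \<in> LTS_class_3"
  unfolding LTS_class_3_def by (simp add: is_LTS_T47 bracket_T47 wedge_def vec_eq_4)

lemma T46_class_3: "(T46 lam :: ('a::field, 4) struct) \<in> LTS_class_3"
  unfolding LTS_class_3_def by (simp add: is_LTS_T46 bracket_T46 wedge_def vec_eq_4)

lemma orbit_LTS_class_3: "mu \<in> LTS_class_3 \<Longrightarrow> orbit mu \<subseteq> LTS_class_3"
  unfolding orbit_def using LTS_class_3_gl_act by auto

lemma closures_subset_LTS_variety: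
  "zariski_closure (orbit T47) \<subseteq> (LTS_variety :: ('a::field, 4) struct set)"
  "zariski_closure (\<Union>lam. orbit (T46 lam)) \<subseteq> (LTS_variety :: ('a::field, 4) struct set)"
proof -
  have "(\<Union>lam. orbit (T46 lam)) \<subseteq> (LTS_class_3 :: ('a, 4) struct set)"
    using orbit_LTS_class_3[OF T46_class_3] by blast
  from zariski_closure_minimal[OF this zariski_closed_LTS_class_3]
  show "zariski_closure (\<Union>lam. orbit (T46 lam)) \<subseteq> (LTS_variety :: ('a, 4) struct set)"
    using LTS_class_3_subset by blast
  from zariski_closure_minimal[OF orbit_LTS_class_3[OF T47_class_3] zariski_closed_LTS_class_3]
  show "zariski_closure (orbit T47) \<subseteq> (LTS_variety :: ('a, 4) struct set)"
    using LTS_class_3_subset by blast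
qed

lemma LTS_variety_4_eq:
  assumes two: "(2::'a::alg_closed_field) \<noteq> 0"
  shows "(LTS_variety :: ('a, 4) struct set) =
    zariski_closure (orbit T47) \<union> zariski_closure (\<Union>lam. orbit (T46 lam))" (is "_ = ?Z1 \<union> ?Z2")
proof (intro equalityI subsetI)
  fix mu :: "('a, 4) struct" assume "mu \<in> LTS_variety"
  then have "nilpotent_LTS mu" by (simp add: LTS_variety_def)
  then show "mu \<in> ?Z1 \<union> ?Z2"
  proof (cases rule: nilpotent_LTS_4_classification[OF two, consumes 1, case_names rank2 rank1])
    case (rank2 g a b d p r)
    have "mu \<in> ?Z1"
      unfolding rank2(3) by (rule gl_act_closure[OF rank2(1) gl_act_in_orbit flagS_in_closure_T47[OF two]])
        (use rank2(1) in auto)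
    then show ?thesis by blast
  next
    case (rank1 g b d p q r)
    have "gl_act g nu \<in> (\<Union>lam. orbit (T46 lam))" if "nu \<in> (\<Union>lam. orbit (T46 lam))" for nu :: "('a, 4) struct"
      using that gl_act_in_orbit[OF _ rank1(1)] by blast
    then have "mu \<in> ?Z2"
      unfolding rank1(2) by (rule gl_act_closure[OF rank1(1) _ flagS_in_closure_T46[OF two]])
    then show ?thesis by blast
  qed
qed (use closures_subset_LTS_variety in blast)

section \<open>Equations that separate the two components\<close>

definition square_zero :: "('a::field, 'n::finite) struct set" where
  "square_zero = {mu. \<forall>x y z. bracket mu x y (bracket mu x y z) = 0}"

lemma zariski_closed_square_zero: "zariski_closed (square_zero :: ('a::field, 'n::finite) struct set)"
  unfolding square_zero_def
  by (intro zariski_closed_Collect_all zariski_closed_vec_eq_0 polyfun_bracket pf_var pf_const)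

lemma square_zero_gl_act: "mu \<in> square_zero \<Longrightarrow> invertible g \<Longrightarrow> gl_act g mu \<in> square_zero"
  unfolding square_zero_def by (simp add: bracket_gl_act matrix_inv_vec)

lemma square_zero_orbit:
  assumes "nu \<in> orbit mu" "nu \<in> square_zero"
  shows "mu \<in> square_zero"
proof -
  obtain g where g: "invertible g" "nu = gl_act g mu" using assms(1) unfolding orbit_def by auto
  have "invertible (matrix_inv g)" using matrix_inv_unique[OF matrix_inv_left[OF g(1)]] by simp
  then have "gl_act (matrix_inv g) nu = mu"
    unfolding g(2) by (simp add: gl_act_mult[symmetric] g(1) matrix_inv_left gl_act_one)
  then show ?thesis using square_zero_gl_act[OF assms(2)] \<open>invertible (matrix_inv g)\<close> by metis
qed

lemma T47_not_square_zero: "(T47 :: ('a::field, 4) struct) \<notin> square_zero"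
proof
  assume "(T47 :: ('a, 4) struct) \<in> square_zero"
  then have "bracket T47 (axis 0 1) (axis 1 1) (bracket T47 (axis 0 1) (axis 1 1) (axis 0 (1::'a))) $ 3 = 0"
    unfolding square_zero_def by simp
  then show False by (simp add: bracket_T47 axis_4 wedge_def)
qed

lemma rank1_square_zero: "flagS 0 b 0 d p q r 0 0 0 \<in> square_zero"
  unfolding square_zero_def by (simp add: bracket_flagS vec_eq_4)

lemma T46_square_zero: "T46 lam \<in> square_zero"
  unfolding square_zero_def by (simp add: bracket_T46 vec_eq_4 wedge_def)

text \<open>In the normal forms \<open>[x,y,[x,y,z]]\<close> is
  \<open>a * p * (wedge x y 0 1)^2 * z $ 0\<close> times \<open>e_3\<close>, with
  \<open>a = 0\<close> in the rank one case. So it is not identically zero exactly when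
  \<open>a\<close> and \<open>p\<close> are nonzero, where \<open>flagS_in_orbit_T47\<close>
  applies. Rigidity is immediate from this equality.\<close>

lemma orbit_T47_eq:
  assumes two: "(2::'a::alg_closed_field) \<noteq> 0"
  shows "orbit T47 = (LTS_variety :: ('a, 4) struct set) - square_zero"
proof (intro equalityI subsetI)
  fix mu :: "('a, 4) struct" assume mu: "mu \<in> orbit T47"
  then have "mu \<in> LTS_variety"
    using closures_subset_LTS_variety(1) zariski_closure_superset by blast
  then show "mu \<in> LTS_variety - square_zero"
    using square_zero_orbit[OF mu] T47_not_square_zero by blast
next
  fix mu :: "('a, 4) struct" assume mu: "mu \<in> LTS_variety - square_zero"
  then have "nilpotent_LTS mu" by (simp add: LTS_variety_def)
  then show "mu \<in> orbit T47"
  proof (cases rule: nilpotent_LTS_4_classification[OF two, consumes 1, case_names rank2 rank1])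
    case (rank2 g a b d p r)
    have "p \<noteq> 0"
    proof
      assume "p = 0"
      then have "flagS a b 0 d p p r 0 0 0 \<in> square_zero"
        unfolding square_zero_def by (simp add: bracket_flagS vec_eq_4)
      then show False using mu square_zero_gl_act rank2 by blast
    qed
    then show ?thesis
      unfolding rank2(3) by (intro gl_act_in_orbit flagS_in_orbit_T47 rank2 two)
  next
    case (rank1 g b d p q r)
    then show ?thesis using mu square_zero_gl_act[OF rank1_square_zero] by blast
  qed
qed

text \<open>For a structure \<open>[x,y,z] = (x \<times> y) \<cdot> A z\<close> with values in a line this is \<open>det A\<close> times a power of
  \<open>det (x, y, z)\<close>; on the orbit of \<open>T47\<close> the matrix has rank at most two.\<close>
definition det3 :: "('a::comm_ring_1 ^'n \<Rightarrow> 'a^'n \<Rightarrow> 'a^'n \<Rightarrow> 'a) \<Rightarrow> 'a^'n \<Rightarrow> 'a^'n \<Rightarrow> 'a^'n \<Rightarrow> 'a" where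
  "det3 m x y z = m y z x * (m z x y * m x y z - m z x z * m x y y)
     - m y z y * (m z x x * m x y z - m z x z * m x y x)
     + m y z z * (m z x x * m x y y - m z x y * m x y x)"

definition degenerate :: "('a::field, 'n::finite) struct set" where
  "degenerate = {mu. \<forall>l x y z. det3 (\<lambda>a b c. bracket mu a b c $ l) x y z = 0}"

lemma zariski_closed_degenerate: "zariski_closed (degenerate :: ('a::field, 'n::finite) struct set)"
  unfolding degenerate_def det3_def
  by (intro zariski_closed_Collect_all zariski_closed_polyfun pf_add polyfun_diff pf_mult
      polyfun_bracket pf_var pf_const)

text \<open>\<open>det3\<close> is the determinant with rows indexed by \<open>(y,z)\<close>,
  \<open>(z,x)\<close>, \<open>(x,y)\<close> and columns by \<open>x\<close>, \<open>y\<close>,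
  \<open>z\<close>; here that matrix factors through dimension two.\<close>

lemma det3_rank_2: "det3 (\<lambda>a b c. f a b * g c + f' a b * g' c) x y z = 0"
  unfolding det3_def by (simp add: algebra_simps)

lemma orbit_T47_degenerate: "orbit T47 \<subseteq> (degenerate :: ('a::field, 4) struct set)"
proof
  fix mu :: "('a, 4) struct" assume "mu \<in> orbit T47"
  then obtain g where mu: "mu = gl_act g T47" unfolding orbit_def by auto
  let ?h = "\<lambda>x. matrix_inv g *v x"
  have eq: "(\<lambda>a b c. bracket mu a b c $ l) = (\<lambda>a b c. wedge (?h a) (?h b) 0 1 * (g $ l $ 2 * ?h c $ 0 + g $ l $ 3 * ?h c $ 2)
      + wedge (?h a) (?h b) 0 2 * (g $ l $ 3 * ?h c $ 1))" for l
    unfolding mu bracket_gl_act bracket_T47 matrix_vector_4[of g] by (simp add: algebra_simps)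
  have "det3 (\<lambda>a b c. bracket mu a b c $ l) x y z = 0" for l x y z
    unfolding eq[of l] by (rule det3_rank_2)
  then show "mu \<in> degenerate" by (simp add: degenerate_def)
qed

text \<open>On the first three basis vectors the matrix of \<open>T46 lam\<close> is diagonal with
  entries \<open>lam\<close>, \<open>1\<close>, \<open>- (lam + 1)\<close>; for
  \<open>lam = 1\<close> its determinant is -2.\<close>

lemma T46_not_degenerate:
  assumes "(2::'a::field) \<noteq> 0"
  shows "(T46 1 :: ('a, 4) struct) \<notin> degenerate"
proof
  assume "(T46 1 :: ('a, 4) struct) \<in> degenerate"
  then have "det3 (\<lambda>a b c. bracket (T46 1) a b c $ 3) (axis 0 1) (axis 1 1) (axis 2 (1::'a)) = 0"
    unfolding degenerate_def by blast
  then show False using assms by (simp add: det3_def bracket_T46 axis_4 wedge_def)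
qed

lemma not_closure_subset:
  assumes two: "(2::'a::field) \<noteq> 0"
  shows "\<not> zariski_closure (orbit (T47 :: ('a, 4) struct)) \<subseteq> zariski_closure (\<Union>lam. orbit (T46 lam))"
    and "\<not> zariski_closure (\<Union>lam. orbit (T46 lam)) \<subseteq> zariski_closure (orbit (T47 :: ('a, 4) struct))"
proof -
  have "(\<Union>lam. orbit (T46 lam)) \<subseteq> (square_zero :: ('a, 4) struct set)"
    using square_zero_gl_act[OF T46_square_zero] unfolding orbit_def by auto
  then have "(T47 :: ('a, 4) struct) \<notin> zariski_closure (\<Union>lam. orbit (T46 lam))"
    using zariski_closure_minimal[OF _ zariski_closed_square_zero] T47_not_square_zero by blast
  then show "\<not> zariski_closure (orbit (T47 :: ('a, 4) struct)) \<subseteq> zariski_closure (\<Union>lam. orbit (T46 lam))"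
    using zariski_closure_superset[of "orbit T47"] orbit_refl[of T47] by blast
  have "(T46 1 :: ('a, 4) struct) \<notin> zariski_closure (orbit T47)"
    using zariski_closure_minimal[OF orbit_T47_degenerate zariski_closed_degenerate]
      T46_not_degenerate[OF two] by blast
  moreover have "(T46 1 :: ('a, 4) struct) \<in> (\<Union>lam. orbit (T46 lam))" using orbit_refl by blast
  ultimately show "\<not> zariski_closure (\<Union>lam. orbit (T46 lam)) \<subseteq> zariski_closure (orbit (T47 :: ('a, 4) struct))"
    using zariski_closure_superset[of "\<Union>lam. orbit (T46 lam)"] by blast
qed

lemma scale_flagS:
  "(\<lambda>t. k * flagS a b c d p q r s u v t) =
     flagS (k * a) (k * b) (k * c) (k * d) (k * p) (k * q) (k * r) (k * s) (k * u) (k * v)"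
  by (rule struct_eqI) (simp add: bracket_scaled_struct bracket_flagS vec_eq_4 algebra_simps)

lemma scale_T47_in_orbit:
  assumes "(2::'a::field) \<noteq> 0" "c \<noteq> 0"
  shows "(\<lambda>t. c * T47 t) \<in> orbit (T47 :: ('a, 4) struct)"
  using flagS_in_orbit_T47[OF assms(1) assms(2) assms(2), of 0 0 0]
  unfolding T47_eq_flagS scale_flagS by simp

text \<open>All products lie on the central line, so stretching that line alone rescales the
  structure.\<close>

lemma scale_T46_in_orbit:
  assumes "c \<noteq> 0"
  shows "(\<lambda>t. c * T46 lam t) \<in> orbit (T46 lam :: ('a::field, 4) struct)"
proof -
  define g where "g = cols (vec4 1 0 0 0) (vec4 0 1 0 0) (vec4 0 0 1 0) (vec4 0 0 0 c)"
  have g: "invertible g"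
    by (rule invertible_if_ker) (use assms in \<open>auto simp: g_def cols_vec vec_eq_4\<close>)
  have "gl_act g (T46 lam) = (\<lambda>t. c * T46 lam t)"
    by (rule gl_act_eqI[OF g])
       (simp add: g_def cols_vec vec_eq_4 bracket_T46 bracket_scaled_struct wedge_def algebra_simps)
  then show ?thesis using g unfolding orbit_def by (auto intro!: exI[of _ g])
qed

lemma orbit_mono: "nu \<in> orbit mu \<Longrightarrow> orbit nu \<subseteq> orbit mu"
  unfolding orbit_def[of nu] using gl_act_in_orbit by auto

text \<open>A scalar parameter is added to meet the scaling condition of
  \<open>irreducible_union_of_orbits\<close>; it does not enlarge the orbit.\<close>

lemma irreducible_orbit_T47:
  assumes two: "(2::'a::alg_closed_field) \<noteq> 0"
  shows "zariski_irreducible (orbit (T47 :: ('a, 4) struct))"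
proof -
  have "zariski_irreducible (\<Union>x\<in>{x :: nat \<Rightarrow> 'a. x 0 \<noteq> 0}. orbit (\<lambda>t. x 0 * (T47 t :: 'a)))"
  proof (rule irreducible_union_of_orbits[OF infinite_UNIV_alg_closed])
    show "(\<lambda>x. x 0 * T47 t) \<in> polyfun" for t :: "4 \<times> 4 \<times> 4 \<times> 4" by (intro pf_mult pf_var pf_const)
    show "(\<lambda>x :: nat \<Rightarrow> 'a. x 0) \<in> polyfun" by (rule pf_var)
    show "(\<lambda>_ :: nat. 1 :: 'a) 0 \<noteq> 0" by simp
    fix x :: "nat \<Rightarrow> 'a" and c :: 'a assume "x 0 \<noteq> 0" "c \<noteq> 0"
    then show "\<exists>x' :: nat \<Rightarrow> 'a. x' 0 \<noteq> 0 \<and> (\<lambda>t. x' 0 * T47 t) = (\<lambda>t. c * (x 0 * T47 t))"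
      by (intro exI[of _ "\<lambda>i. c * x i"]) (simp add: mult.assoc)
  qed
  moreover have "(\<Union>x\<in>{x :: nat \<Rightarrow> 'a. x 0 \<noteq> 0}. orbit (\<lambda>t. x 0 * (T47 t :: 'a))) = orbit T47" (is "?U = _")
  proof
    show "?U \<subseteq> orbit T47" using orbit_mono[OF scale_T47_in_orbit[OF two]] by blast
    have "orbit (\<lambda>t. (\<lambda>_. 1 :: 'a) (0::nat) * T47 t) \<subseteq> ?U" by (intro UN_upper) simp
    then show "orbit T47 \<subseteq> ?U" by simp
  qed
  ultimately show ?thesis by simp
qed

lemma irreducible_orbits_T46:
  "zariski_irreducible (\<Union>lam::'a::alg_closed_field. orbit (T46 lam))"
proof -
  have "zariski_irreducible (\<Union>x\<in>{x :: nat \<Rightarrow> 'a. x 0 \<noteq> 0}. orbit (\<lambda>t. x 0 * (T46 (x 1) t :: 'a)))"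
  proof (rule irreducible_union_of_orbits[OF infinite_UNIV_alg_closed])
    show "(\<lambda>x. x 0 * T46 (x 1) t) \<in> polyfun" for t :: "4 \<times> 4 \<times> 4 \<times> 4"
      unfolding T46_eq_flagS
      by (intro pf_mult pf_var polyfun_flagS pf_const polyfun_uminus pf_add)
    show "(\<lambda>x :: nat \<Rightarrow> 'a. x 0) \<in> polyfun" by (rule pf_var)
    show "(\<lambda>_ :: nat. 1 :: 'a) 0 \<noteq> 0" by simp
    fix x :: "nat \<Rightarrow> 'a" and c :: 'a assume "x 0 \<noteq> 0" "c \<noteq> 0"
    then show "\<exists>x' :: nat \<Rightarrow> 'a. x' 0 \<noteq> 0 \<and> (\<lambda>t. x' 0 * T46 (x' 1) t) = (\<lambda>t. c * (x 0 * T46 (x 1) t))"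
      by (intro exI[of _ "x(0 := c * x 0)"]) (simp add: mult.assoc)
  qed
  moreover have "(\<Union>x\<in>{x :: nat \<Rightarrow> 'a. x 0 \<noteq> 0}. orbit (\<lambda>t. x 0 * (T46 (x 1) t :: 'a)))
      = (\<Union>lam. orbit (T46 lam))" (is "?U = ?V")
  proof
    show "?U \<subseteq> ?V" using orbit_mono[OF scale_T46_in_orbit] by blast
    have "orbit (T46 lam) \<subseteq> ?U" for lam :: 'a
    proof -
      have "orbit (\<lambda>t. (\<lambda>i. if i = 0 then 1 else lam) (0::nat) * T46 ((\<lambda>i. if i = 0 then 1 else lam) (1::nat)) t) \<subseteq> ?U"
        by (intro UN_upper) simp
      then show ?thesis by simp
    qed
    then show "?V \<subseteq> ?U" by blast
  qed
  ultimately show ?thesis by simp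
qed

lemma irreducible_closure: "zariski_irreducible S \<Longrightarrow> zariski_irreducible (zariski_closure S)"
  for S :: "('i \<Rightarrow> 'a::idom) set"
  by (erule zariski_irreducible_between[OF _ zariski_closure_superset order_refl])

section \<open>The dimension of the orbit of \<open>T47\<close>\<close>

text \<open>Coordinates on the big cell of the flag variety: the stabiliser of the flag
  \<open><e_3>\<close>, \<open><e_2,e_3>\<close>, \<open><e_1,e_2,e_3>\<close> is lower triangular,
  so upper unitriangular matrices represent generic flags. Indices follow the order in which the
  dimension chain frees the parameters.\<close>

definition unip :: "(nat \<Rightarrow> 'a::field) \<Rightarrow> 'a^4^4" where
  "unip x = cols (vec4 1 0 0 0) (vec4 (x 10) 1 0 0) (vec4 (x 9) (x 8) 1 0) (vec4 (x 7) (x 6) (x 5) 1)"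

definition unip_inv :: "(nat \<Rightarrow> 'a::field) \<Rightarrow> 'a^4^4" where
  "unip_inv x = cols (vec4 1 0 0 0) (vec4 (- x 10) 1 0 0) (vec4 (x 10 * x 8 - x 9) (- x 8) 1 0)
     (vec4 (x 10 * x 6 + x 9 * x 5 - x 7 - x 10 * x 8 * x 5) (x 8 * x 5 - x 6) (- x 5) 1)"

lemma unip_inv_vec: "unip_inv x *v (unip x *v y) = y" "unip x *v (unip_inv x *v y) = y"
  by (simp_all add: unip_def unip_inv_def cols_vec vec_eq_4 algebra_simps)

lemma invertible_unip: "invertible (unip_inv x)" "matrix_inv (unip_inv x) = unip x"
proof -
  have "unip_inv x ** unip x = mat 1"
    by (simp add: matrix_eq matrix_vector_mul_assoc[symmetric] unip_inv_vec)
  then show "invertible (unip_inv x)" "matrix_inv (unip_inv x) = unip x"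
    by (rule matrix_inv_unique)+
qed

text \<open>Six parameters for a generic full flag and five for the structures adapted to it.\<close>
definition param :: "(nat \<Rightarrow> 'a::field) \<Rightarrow> ('a, 4) struct" where
  "param x = act2 (unip_inv x) (unip x) (flagS (1 + x 0) (x 2) 0 (x 3) (1 + x 1) (1 + x 1) (x 4) 0 0 0)"

lemma param_eq_gl_act:
  "param x = gl_act (unip_inv x) (flagS (1 + x 0) (x 2) 0 (x 3) (1 + x 1) (1 + x 1) (x 4) 0 0 0)"
  by (simp add: param_def gl_act_eq_act2 invertible_unip)

lemma polyfun_cols:
  assumes "\<And>i. (\<lambda>x. f0 x $ i) \<in> polyfun" "\<And>i. (\<lambda>x. f1 x $ i) \<in> polyfun"
    "\<And>i. (\<lambda>x. f2 x $ i) \<in> polyfun" "\<And>i. (\<lambda>x. f3 x $ i) \<in> polyfun"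
  shows "(\<lambda>x. cols (f0 x) (f1 x) (f2 x) (f3 x) $ i $ j) \<in> polyfun"
proof -
  have "j = 0 \<or> j = 1 \<or> j = 2 \<or> j = 3" using UNIV_4' by auto
  then show ?thesis using assms by (auto simp: cols_def)
qed

lemma polyfun_vec4:
  assumes "a \<in> polyfun" "b \<in> polyfun" "c \<in> polyfun" "d \<in> polyfun"
  shows "(\<lambda>x. vec4 (a x) (b x) (c x) (d x) $ i) \<in> polyfun"
proof -
  have "i = 0 \<or> i = 1 \<or> i = 2 \<or> i = 3" using UNIV_4' by auto
  then show ?thesis using assms by auto
qed

lemma polyfun_param: "(\<lambda>x. param x t) \<in> polyfun"
  unfolding param_def unip_def unip_inv_def
  by (intro polyfun_act2 polyfun_flagS polyfun_cols polyfun_vec4 pf_const pf_var pf_add pf_mult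
      polyfun_diff polyfun_uminus)

section \<open>Upper bound: generic orbit points have eleven parameters\<close>

lemma lower_triangular_T47:
  fixes w :: "'a::field^4^4"
  assumes two: "(2::'a) \<noteq> 0" and w: "invertible w" and c: "c \<noteq> 0"
    and tri: "w$0$1 = 0" "w$0$2 = 0" "w$0$3 = 0" "w$1$2 = 0" "w$1$3 = 0" "w$2$3 = 0"
  shows "\<exists>a b d p r. gl_act w (\<lambda>t. c * T47 t) = flagS a b 0 d p p r 0 0 0"
proof -
  let ?nu = "gl_act w (\<lambda>t. c * T47 t)" and ?h = "\<lambda>x. matrix_inv w *v x"
  \<comment> \<open>The columns of the inverse; solving \<open>w *v X i = axis i 1\<close> row by
    row shows that they are lower triangular too.\<close>
  define X where "X i = ?h (axis i 1)" for i
  have wX: "w *v X i = axis i 1" for i by (simp add: X_def matrix_inv_vec w)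
  have X0: "w$0$0 * X 0 $ 0 = 1"
    using arg_cong[OF wX[of 0], of "\<lambda>v. v $ 0"] by (simp add: matrix_vector_4 tri axis_4)
  then have w00: "w$0$0 \<noteq> 0" by auto
  have Xi0: "X 1 $ 0 = 0" "X 2 $ 0 = 0" "X 3 $ 0 = 0"
    using arg_cong[OF wX[of 1], of "\<lambda>v. v $ 0"] arg_cong[OF wX[of 2], of "\<lambda>v. v $ 0"]
      arg_cong[OF wX[of 3], of "\<lambda>v. v $ 0"] w00 by (simp_all add: matrix_vector_4 tri axis_4)
  have X1: "w$1$1 * X 1 $ 1 = 1"
    using arg_cong[OF wX[of 1], of "\<lambda>v. v $ 1"] by (simp add: matrix_vector_4 tri axis_4 Xi0)
  then have w11: "w$1$1 \<noteq> 0" by auto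
  have Xi1: "X 2 $ 1 = 0" "X 3 $ 1 = 0"
    using arg_cong[OF wX[of 2], of "\<lambda>v. v $ 1"] arg_cong[OF wX[of 3], of "\<lambda>v. v $ 1"] w11
    by (simp_all add: matrix_vector_4 tri axis_4 Xi0)
  have X2: "w$2$2 * X 2 $ 2 = 1"
    using arg_cong[OF wX[of 2], of "\<lambda>v. v $ 2"] by (simp add: matrix_vector_4 tri axis_4 Xi0 Xi1)
  then have w22: "w$2$2 \<noteq> 0" by auto
  have Xi2: "X 3 $ 2 = 0"
    using arg_cong[OF wX[of 3], of "\<lambda>v. v $ 2"] w22 by (simp add: matrix_vector_4 tri axis_4 Xi0 Xi1)
  have br: "bracket ?nu x y z = w *v (c *s bracket T47 (?h x) (?h y) (?h z))" for x y z
    by (simp add: bracket_gl_act bracket_scaled_struct)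
  have L: "is_LTS ?nu"
  proof -
    have "(\<lambda>t. c * T47 t) \<in> LTS_class_3"
      using scale_T47_in_orbit[OF two c] orbit_LTS_class_3[OF T47_class_3] by blast
    then show ?thesis using LTS_class_3_gl_act[OF _ w] unfolding LTS_class_3_def by blast
  qed
  \<comment> \<open>Lower triangular matrices preserve the flag to which \<open>T47\<close> is
    adapted.\<close>
  have "flag_adapted ?nu"
    unfolding flag_adapted_def br X_def[symmetric]
    by (simp add: bracket_T47 matrix_vector_4 tri Xi0 Xi1 Xi2 wedge_def vec_eq_4)
  then obtain a b c' d p q r s u v where nu: "?nu = flagS a b c' d p q r s u v"
    and a: "a = ?nu (0,1,0,2)" and c': "c' = ?nu (0,1,1,2)"
    using flag_adapted_eq_flagS[OF two L] by blast
  have "a = w$2$2 * c * X 0 $ 0 * X 0 $ 0 * X 1 $ 1"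
    unfolding a bracket_axis[of ?nu, symmetric] br X_def[symmetric]
    by (simp add: bracket_T47 matrix_vector_4 tri Xi0 wedge_def)
  then have a0: "a \<noteq> 0" using X0 X1 w22 c by auto
  \<comment> \<open>The inverse sends \<open>e_1\<close> into \<open><e_1,e_2,e_3>\<close>, where
    the factor \<open>z $ 0\<close> in the \<open>e_2\<close>-component of \<open>T47\<close>
    vanishes.\<close>
  have c'0: "c' = 0"
    unfolding c' bracket_axis[of ?nu, symmetric] br X_def[symmetric]
    by (simp add: bracket_T47 matrix_vector_4 tri Xi0 wedge_def)
  show ?thesis
    using flagS_normal[of a b d p q r s u v] L a0 unfolding nu c'0 by blast
qed

definition dd :: "'a::comm_ring_1 \<Rightarrow> 'a \<Rightarrow> 'a \<Rightarrow> 'a \<Rightarrow> 'a \<Rightarrow> 'a \<Rightarrow> 'a \<Rightarrow> 'a \<Rightarrow> 'a \<Rightarrow> 'a" where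
  "dd a1 a2 a3 b1 b2 b3 c1 c2 c3 = a1 * (b2 * c3 - b3 * c2) - a2 * (b1 * c3 - b3 * c1) + a3 * (b1 * c2 - b2 * c1)"

text \<open>Cramer's rule for writing the row \<open>x\<close> as a combination of the rows
  \<open>a\<close>, \<open>b\<close>, \<open>c\<close>.\<close>

lemma cramer_dd:
  "dd x1 x2 x3 b1 b2 b3 c1 c2 c3 * a1 + dd a1 a2 a3 x1 x2 x3 c1 c2 c3 * b1 + dd a1 a2 a3 b1 b2 b3 x1 x2 x3 * c1
     = dd a1 a2 a3 b1 b2 b3 c1 c2 c3 * x1"
  "dd x1 x2 x3 b1 b2 b3 c1 c2 c3 * a2 + dd a1 a2 a3 x1 x2 x3 c1 c2 c3 * b2 + dd a1 a2 a3 b1 b2 b3 x1 x2 x3 * c2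
     = dd a1 a2 a3 b1 b2 b3 c1 c2 c3 * x2"
  "dd x1 x2 x3 b1 b2 b3 c1 c2 c3 * a3 + dd a1 a2 a3 x1 x2 x3 c1 c2 c3 * b3 + dd a1 a2 a3 b1 b2 b3 x1 x2 x3 * c3
     = dd a1 a2 a3 b1 b2 b3 c1 c2 c3 * x3"
  by (simp_all add: dd_def algebra_simps)

text \<open>The equations say that a unitriangular matrix times \<open>g\<close> has no entries
  above the diagonal. They split by rows into systems whose determinants are the lower right minors
  assumed nonzero.\<close>

lemma generic_triangular_factor:
  fixes g :: "'a::field^4^4"
  assumes m1: "g$3$3 \<noteq> 0" and m2: "g$2$2 * g$3$3 - g$2$3 * g$3$2 \<noteq> 0"
    and m3: "dd (g$1$1) (g$1$2) (g$1$3) (g$2$1) (g$2$2) (g$2$3) (g$3$1) (g$3$2) (g$3$3) \<noteq> 0"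
  shows "\<exists>y5 y6 y7 y8 y9 y10.
    y10 * g$1$1 + y9 * g$2$1 + y7 * g$3$1 = - g$0$1 \<and>
    y10 * g$1$2 + y9 * g$2$2 + y7 * g$3$2 = - g$0$2 \<and>
    y10 * g$1$3 + y9 * g$2$3 + y7 * g$3$3 = - g$0$3 \<and>
    y8 * g$2$2 + y6 * g$3$2 = - g$1$2 \<and> y8 * g$2$3 + y6 * g$3$3 = - g$1$3 \<and>
    y5 * g$3$3 = - g$2$3"
proof -
  define M3 where "M3 = dd (g$1$1) (g$1$2) (g$1$3) (g$2$1) (g$2$2) (g$2$3) (g$3$1) (g$3$2) (g$3$3)"
  define M2 where "M2 = g$2$2 * g$3$3 - g$2$3 * g$3$2"
  note nz = m1 m2[folded M2_def] m3[folded M3_def]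
  define y10 where "y10 = - dd (g$0$1) (g$0$2) (g$0$3) (g$2$1) (g$2$2) (g$2$3) (g$3$1) (g$3$2) (g$3$3) / M3"
  define y9 where "y9 = - dd (g$1$1) (g$1$2) (g$1$3) (g$0$1) (g$0$2) (g$0$3) (g$3$1) (g$3$2) (g$3$3) / M3"
  define y7 where "y7 = - dd (g$1$1) (g$1$2) (g$1$3) (g$2$1) (g$2$2) (g$2$3) (g$0$1) (g$0$2) (g$0$3) / M3"
  define y8 where "y8 = - (g$1$2 * g$3$3 - g$1$3 * g$3$2) / M2"
  define y6 where "y6 = - (g$1$3 * g$2$2 - g$1$2 * g$2$3) / M2"
  define y5 where "y5 = - g$2$3 / g$3$3"
  have comb: "- A / M3 * a + - B / M3 * b + - C / M3 * c = - x" if "A * a + B * b + C * c = M3 * x" for A B C a b c x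
  proof -
    have "- A / M3 * a + - B / M3 * b + - C / M3 * c = - (A * a + B * b + C * c) / M3"
      by (simp add: add_divide_distrib diff_divide_distrib)
    then show ?thesis using that nz by simp
  qed
  have comb2: "- A / M2 * a + - B / M2 * b = - x" if "A * a + B * b = M2 * x" for A B a b x
  proof -
    have "- A / M2 * a + - B / M2 * b = - (A * a + B * b) / M2"
      by (simp add: add_divide_distrib diff_divide_distrib)
    then show ?thesis using that nz by simp
  qed
  show ?thesis
  proof (intro exI conjI)
    show "y10 * g$1$1 + y9 * g$2$1 + y7 * g$3$1 = - g$0$1"
      unfolding y10_def y9_def y7_def by (rule comb) (unfold M3_def, rule cramer_dd)
    show "y10 * g$1$2 + y9 * g$2$2 + y7 * g$3$2 = - g$0$2"
      unfolding y10_def y9_def y7_def by (rule comb) (unfold M3_def, rule cramer_dd)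
    show "y10 * g$1$3 + y9 * g$2$3 + y7 * g$3$3 = - g$0$3"
      unfolding y10_def y9_def y7_def by (rule comb) (unfold M3_def, rule cramer_dd)
    show "y8 * g$2$2 + y6 * g$3$2 = - g$1$2"
      unfolding y8_def y6_def by (rule comb2) (simp add: M2_def algebra_simps)
    show "y8 * g$2$3 + y6 * g$3$3 = - g$1$3"
      unfolding y8_def y6_def by (rule comb2) (simp add: M2_def algebra_simps)
    show "y5 * g$3$3 = - g$2$3" using nz by (simp add: y5_def)
  qed
qed

lemma matrix_mult_4: "((A :: 'a::comm_ring_1^4^4) ** B) $ i $ j =
    A$i$0 * B$0$j + A$i$1 * B$1$j + A$i$2 * B$2$j + A$i$3 * B$3$j"
  by (simp add: matrix_matrix_mult_def sum_4')

lemma cols_nth [simp]: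
  "cols f0 f1 f2 f3 $ i $ 0 = f0 $ i" "cols f0 f1 f2 f3 $ i $ 1 = f1 $ i"
  "cols f0 f1 f2 f3 $ i $ 2 = f2 $ i" "cols f0 f1 f2 f3 $ i $ 3 = f3 $ i"
  by (simp_all add: cols_def)

lemma generic_orbit_point_in_param:
  fixes g :: "'a::field^4^4"
  assumes two: "(2::'a) \<noteq> 0" and g: "invertible g" and c: "c \<noteq> 0"
    and m1: "g$3$3 \<noteq> 0" and m2: "g$2$2 * g$3$3 - g$2$3 * g$3$2 \<noteq> 0"
    and m3: "dd (g$1$1) (g$1$2) (g$1$3) (g$2$1) (g$2$2) (g$2$3) (g$3$1) (g$3$2) (g$3$3) \<noteq> 0"
  shows "gl_act g (\<lambda>t. c * T47 t) \<in> param ` {x. \<forall>j\<ge>11. x j = 0}"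
proof -
  obtain y5 y6 y7 y8 y9 y10 where y:
    "y10 * g$1$1 + y9 * g$2$1 + y7 * g$3$1 = - g$0$1"
    "y10 * g$1$2 + y9 * g$2$2 + y7 * g$3$2 = - g$0$2"
    "y10 * g$1$3 + y9 * g$2$3 + y7 * g$3$3 = - g$0$3"
    "y8 * g$2$2 + y6 * g$3$2 = - g$1$2" "y8 * g$2$3 + y6 * g$3$3 = - g$1$3" "y5 * g$3$3 = - g$2$3"
    using generic_triangular_factor[OF m1 m2 m3] by blast
  define x0 :: "nat \<Rightarrow> 'a" where "x0 = (\<lambda>_. 0)(5 := y5, 6 := y6, 7 := y7, 8 := y8, 9 := y9, 10 := y10)"
  define w where "w = unip x0 ** g"
  have "invertible (unip x0)"
    by (rule matrix_inv_unique(3)[of "unip_inv x0"])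
       (simp add: matrix_eq matrix_vector_mul_assoc[symmetric] unip_inv_vec)
  then have w: "invertible w" unfolding w_def using g by (rule invertible_mult)
  have "w$0$1 = 0" "w$0$2 = 0" "w$0$3 = 0" "w$1$2 = 0" "w$1$3 = 0" "w$2$3 = 0"
    using y by (simp_all add: w_def matrix_mult_4 unip_def x0_def add.assoc)
  then obtain a b d p r where nu: "gl_act w (\<lambda>t. c * T47 t) = flagS a b 0 d p p r 0 0 0"
    using lower_triangular_T47[OF two w c] by blast
  \<comment> \<open>The subtraction of 1 undoes the shift built into \<open>param\<close>.\<close>
  define x where "x = x0(0 := a - 1, 1 := p - 1, 2 := b, 3 := d, 4 := r)"
  have "g = unip_inv x0 ** w"
    by (simp add: w_def matrix_eq matrix_vector_mul_assoc[symmetric] unip_inv_vec)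
  then have "gl_act g (\<lambda>t. c * T47 t) = gl_act (unip_inv x0) (flagS a b 0 d p p r 0 0 0)"
    by (simp add: gl_act_mult invertible_unip w nu)
  also have "\<dots> = param x"
    by (simp add: param_eq_gl_act x_def unip_inv_def)
  finally have "gl_act g (\<lambda>t. c * T47 t) = param x" .
  moreover have "\<forall>j\<ge>11. x j = 0" by (simp add: x_def x0_def)
  ultimately show ?thesis by blast
qed

lemma orbit_T47_subset_closure_param:
  assumes two: "(2::'a::alg_closed_field) \<noteq> 0"
  shows "orbit (T47 :: ('a, 4) struct) \<subseteq> zariski_closure (param ` {x. \<forall>j\<ge>11. x j = 0})"
proof (rule orbit_subset_closure_if_generic[OF infinite_UNIV_alg_closed])
  let ?P = "\<lambda>s :: 4 \<times> 4 \<Rightarrow> 'a. s (3,3) * (s (2,2) * s (3,3) - s (2,3) * s (3,2)) *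
    dd (s (1,1)) (s (1,2)) (s (1,3)) (s (2,1)) (s (2,2)) (s (2,3)) (s (3,1)) (s (3,2)) (s (3,3))"
  let ?s = "\<lambda>(i, j). if i = j then 1 else 0 :: 'a"
  show "?P \<in> polyfun" unfolding dd_def by (intro pf_mult pf_add polyfun_diff pf_var)
  show "?P ?s \<noteq> 0" by (simp add: dd_def)
  have "(\<chi> i j. ?s (i, j)) = (mat 1 :: 'a^4^4)" by (simp add: mat_def)
  then show "det ((\<chi> i j. ?s (i, j)) :: 'a^4^4) \<noteq> 0" by simp
  fix g :: "'a^4^4" and c :: 'a
  assume "invertible g" "?P (\<lambda>(i, j). g $ i $ j) \<noteq> 0" "c \<noteq> 0"
  then show "gl_act g (\<lambda>t. c * T47 t) \<in> param ` {x. \<forall>j\<ge>11. x j = 0}"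
    by (intro generic_orbit_point_in_param[OF two]) auto
qed

section \<open>Lower bound: a chain of length eleven in the orbit\<close>

definition separates :: "nat \<Rightarrow> (('a::field, 4) struct \<Rightarrow> 'a) \<Rightarrow> bool" where
  "separates n q \<longleftrightarrow> q \<in> polyfun \<and> (\<forall>x. (\<forall>j\<ge>n. x j = 0) \<longrightarrow> q (param x) = 0)
     \<and> q (param (\<lambda>j. if j = n then 1 else 0)) \<noteq> 0"

lemma separatesI:
  assumes "q \<in> polyfun" "\<And>x. (\<And>j. n \<le> j \<Longrightarrow> x j = 0) \<Longrightarrow> q (param x) = 0"
    and "q (param (\<lambda>j. if j = n then 1 else 0)) \<noteq> 0"
  shows "separates n q"
  using assms unfolding separates_def by auto

lemmas param_simps = param_def act2_def unip_def unip_inv_def cols_vec axis_4 bracket_flagS wedge_def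

text \<open>The parameters are switched on one at a time: first the structure constants, then the
  coordinates of the line \<open>T\<^sup>(\<^sup>2\<^sup>)\<close>, then those of the plane \<open>T\<^sup>(\<^sup>1\<^sup>)\<close>, and finally the last one, detected by
  \<open>[e\<^sub>0, e\<^sub>1, e\<^sub>1]\<close> leaving the line spanned by \<open>[e\<^sub>0, e\<^sub>1, [e\<^sub>0, e\<^sub>1, e\<^sub>0]]\<close>.\<close>
lemma exists_separates:
  assumes "n < 11"
  shows "\<exists>q :: ('a::field, 4) struct \<Rightarrow> 'a. separates n q"
proof -
  have "n = 0 \<or> n = 1 \<or> n = 2 \<or> n = 3 \<or> n = 4 \<or> n = 5 \<or> n = 6 \<or> n = 7 \<or> n = 8 \<or> n = 9 \<or> n = 10"
    using assms by presburger
  moreover have "separates 0 (\<lambda>mu :: ('a, 4) struct. mu (0,1,0,2) - 1)"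
    by (rule separatesI) (intro polyfun_diff pf_var pf_const, simp_all add: param_simps)
  moreover have "separates 1 (\<lambda>mu :: ('a, 4) struct. mu (0,1,2,3) - 1)"
    by (rule separatesI) (intro polyfun_diff pf_var pf_const, simp_all add: param_simps)
  moreover have "separates 2 (\<lambda>mu :: ('a, 4) struct. mu (0,1,0,3))"
    by (rule separatesI) (rule pf_var, simp_all add: param_simps)
  moreover have "separates 3 (\<lambda>mu :: ('a, 4) struct. mu (0,1,1,3))"
    by (rule separatesI) (rule pf_var, simp_all add: param_simps)
  moreover have "separates 4 (\<lambda>mu :: ('a, 4) struct. mu (0,2,0,3))"
    by (rule separatesI) (rule pf_var, simp_all add: param_simps)
  moreover have "separates 5 (\<lambda>mu :: ('a, 4) struct. mu (0,1,2,2))"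
    by (rule separatesI) (rule pf_var, simp_all add: param_simps)
  moreover have "separates 6 (\<lambda>mu :: ('a, 4) struct. mu (0,1,2,1))"
    by (rule separatesI) (rule pf_var, simp_all add: param_simps)
  moreover have "separates 7 (\<lambda>mu :: ('a, 4) struct. mu (0,1,2,0))"
    by (rule separatesI) (rule pf_var, simp_all add: param_simps)
  \<comment> \<open>For parameters 8 and 9: while the tested parameter and all later ones are zero,
    \<open>[e_0,e_1,e_2]\<close> lies on the image of \<open><e_3>\<close>, and the minor sees
    \<open>[e_0,e_1,e_0]\<close> only modulo that line.\<close>
  moreover have "separates 8 (\<lambda>mu :: ('a, 4) struct. mu (0,1,0,1) * mu (0,1,2,3) - mu (0,1,0,3) * mu (0,1,2,1))"
    by (rule separatesI) (intro polyfun_diff pf_mult pf_var, simp_all add: param_simps)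
  moreover have "separates 9 (\<lambda>mu :: ('a, 4) struct. mu (0,1,0,0) * mu (0,1,2,3) - mu (0,1,0,3) * mu (0,1,2,0))"
    by (rule separatesI) (intro polyfun_diff pf_mult pf_var, simp_all add: param_simps algebra_simps)
  moreover have "separates 10 (\<lambda>mu :: ('a, 4) struct.
      bracket mu (axis 0 1) (axis 1 1) (axis 1 1) $ 2 *
        bracket mu (axis 0 1) (axis 1 1) (bracket mu (axis 0 1) (axis 1 1) (axis 0 1)) $ 3
      - bracket mu (axis 0 1) (axis 1 1) (axis 1 1) $ 3 *
        bracket mu (axis 0 1) (axis 1 1) (bracket mu (axis 0 1) (axis 1 1) (axis 0 1)) $ 2)"
  proof (rule separatesI)
    show "(\<lambda>mu :: ('a, 4) struct.
      bracket mu (axis 0 1) (axis 1 1) (axis 1 1) $ 2 *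
        bracket mu (axis 0 1) (axis 1 1) (bracket mu (axis 0 1) (axis 1 1) (axis 0 1)) $ 3
      - bracket mu (axis 0 1) (axis 1 1) (axis 1 1) $ 3 *
        bracket mu (axis 0 1) (axis 1 1) (bracket mu (axis 0 1) (axis 1 1) (axis 0 1)) $ 2) \<in> polyfun"
      by (intro polyfun_diff pf_mult polyfun_bracket pf_var pf_const)
  qed (simp_all add: param_def bracket_act2 unip_inv_vec,
       simp_all add: unip_def unip_inv_def cols_vec axis_4 bracket_flagS wedge_def)
  ultimately show ?thesis by blast
qed

text \<open>The shift by one in \<open>param\<close> places the zero parameter at \<open>T47\<close>
  itself, so every truncation of the parameters meets the orbit.\<close>

lemma param_in_orbit_T47:
  assumes "(2::'a::field) \<noteq> 0" "1 + x 0 \<noteq> 0" "1 + x 1 \<noteq> (0::'a)"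
  shows "param x \<in> orbit T47"
  unfolding param_eq_gl_act
  by (intro gl_act_in_orbit flagS_in_orbit_T47 invertible_unip assms)

lemma zariski_dim_orbit_T47_ge:
  assumes two: "(2::'a::alg_closed_field) \<noteq> 0"
  shows "11 \<le> zariski_dim (orbit (T47 :: ('a, 4) struct))"
proof -
  define \<delta> where "\<delta> x = (1 + x 0) * (1 + x 1)" for x :: "nat \<Rightarrow> 'a"
  define Y where "Y i = {x. (\<forall>j\<ge>i. x j = 0) \<and> \<delta> x \<noteq> 0}" for i
  define Z where "Z i = zariski_closure (param ` Y i) \<inter> orbit (T47 :: ('a, 4) struct)" for i
  have sub: "param ` Y i \<subseteq> orbit T47" for i
    unfolding Y_def \<delta>_def using param_in_orbit_T47[OF two] by auto
  have irr: "zariski_irreducible (Z i)" for i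
  proof -
    define tr where "tr x j = (if j < i then x j else 0)" for x :: "nat \<Rightarrow> 'a" and j
    have tr: "(\<lambda>x. tr x j) \<in> polyfun" for j
      unfolding tr_def by (cases "j < i") (simp_all add: pf_var pf_const)
    have \<delta>: "\<delta> \<in> polyfun" unfolding \<delta>_def[abs_def] by (intro pf_mult pf_add pf_var pf_const)
    have "zariski_irreducible ((\<lambda>x. param (tr x)) ` {x. \<delta> (tr x) \<noteq> 0})"
    proof (rule zariski_irreducible_image[OF zariski_irreducible_principal_open[OF infinite_UNIV_alg_closed]])
      show "(\<lambda>x. \<delta> (tr x)) \<in> polyfun" by (rule polyfun_compose[OF \<delta> tr])
      show "\<delta> (tr (\<lambda>_. 0)) \<noteq> 0" by (simp add: \<delta>_def tr_def)
      show "(\<lambda>x. param (tr x) t) \<in> polyfun" for t by (rule polyfun_compose[OF polyfun_param tr])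
    qed
    moreover have "(\<lambda>x. param (tr x)) ` {x. \<delta> (tr x) \<noteq> 0} = param ` Y i"
    proof (intro equalityI subsetI)
      fix mu assume "mu \<in> (\<lambda>x. param (tr x)) ` {x. \<delta> (tr x) \<noteq> 0}"
      then obtain x where "mu = param (tr x)" "\<delta> (tr x) \<noteq> 0" by auto
      then show "mu \<in> param ` Y i" by (intro image_eqI[of _ _ "tr x"]) (auto simp: Y_def tr_def)
    next
      fix mu assume "mu \<in> param ` Y i"
      then obtain x where x: "mu = param x" "x \<in> Y i" by auto
      then have "tr x = x" by (auto simp: Y_def tr_def fun_eq_iff)
      then show "mu \<in> (\<lambda>x. param (tr x)) ` {x. \<delta> (tr x) \<noteq> 0}"
        using x by (intro image_eqI[of _ _ x]) (auto simp: Y_def)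
    qed
    ultimately have "zariski_irreducible (param ` Y i)" by simp
    then show ?thesis
      by (rule zariski_irreducible_between)
        (use sub[of i] zariski_closure_superset[of "param ` Y i"] in \<open>auto simp: Z_def\<close>)
  qed
  have rel: "rel_closed (orbit T47) (Z i)" for i :: nat
    unfolding rel_closed_def Z_def using zariski_closed_closure by blast
  have strict: "Z i \<subset> Z (Suc i)" if "i < 11" for i
  proof
    have "Y i \<subseteq> Y (Suc i)" by (auto simp: Y_def)
    then have "param ` Y i \<subseteq> zariski_closure (param ` Y (Suc i))"
      using zariski_closure_superset by blast
    then show "Z i \<subseteq> Z (Suc i)"
      unfolding Z_def using zariski_closure_minimal[OF _ zariski_closed_closure] by blast
    obtain q :: "('a, 4) struct \<Rightarrow> 'a" where q: "separates i q" using exists_separates[OF \<open>i < 11\<close>] by blast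
    let ?x = "\<lambda>j. if j = i then 1 else 0 :: 'a"
    \<comment> \<open>For \<open>i = 0\<close> and \<open>i = 1\<close> the value of
      \<open>\<delta>\<close> is 2, otherwise it is 1.\<close>
    have "?x \<in> Y (Suc i)" using two by (auto simp: Y_def \<delta>_def)
    then have "param ?x \<in> Z (Suc i)"
      unfolding Z_def using sub zariski_closure_superset by blast
    moreover have "param ?x \<notin> Z i"
    proof
      assume "param ?x \<in> Z i"
      then have "param ?x \<in> zariski_closure (param ` Y i)" by (simp add: Z_def)
      then have "q (param ?x) = 0"
        by (rule zariski_closureD) (use q in \<open>auto simp: separates_def Y_def\<close>)
      then show False using q by (simp add: separates_def)
    qed
    ultimately show "Z i \<noteq> Z (Suc i)" by auto
  qed
  have "enat 11 \<le> zariski_dim (orbit (T47 :: ('a, 4) struct))"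
    unfolding zariski_dim_def
    by (rule Sup_upper) (use irr rel strict in blast)
  then show ?thesis by (simp add: numeral_eq_enat)
qed

theorem mainTheorem4:
  fixes dummy :: "'a::alg_closed_field"
  assumes "(2::'a) \<noteq> 0" and "(3::'a) \<noteq> 0"
  shows "{Z. irreducible_component (LTS_variety :: ('a, 4) struct set) Z}
           = {zariski_closure (orbit (T47 :: ('a, 4) struct)),
              zariski_closure (\<Union>lam::'a. orbit (T46 lam))}
       \<and> zariski_closure (orbit (T47 :: ('a, 4) struct))
           \<noteq> zariski_closure (\<Union>lam::'a. orbit (T46 lam))
       \<and> rigid (T47 :: ('a, 4) struct)
       \<and> zariski_dim (orbit (T47 :: ('a, 4) struct)) = 11"
proof (intro conjI)
  note two = assms(1)
  show "{Z. irreducible_component (LTS_variety :: ('a, 4) struct set) Z}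
      = {zariski_closure (orbit T47), zariski_closure (\<Union>lam. orbit (T46 lam))}"
    by (rule irreducible_components_of_union[OF zariski_closed_closure zariski_closed_closure
          irreducible_closure[OF irreducible_orbit_T47[OF two]] irreducible_closure[OF irreducible_orbits_T46]
          LTS_variety_4_eq[OF two] not_closure_subset[OF two]])
  show "zariski_closure (orbit (T47 :: ('a, 4) struct)) \<noteq> zariski_closure (\<Union>lam. orbit (T46 lam))"
    using not_closure_subset(1)[OF two] by blast
  show "rigid (T47 :: ('a, 4) struct)"
    unfolding rigid_def rel_open_def using orbit_T47_eq[OF two] zariski_closed_square_zero by blast
  have "zariski_dim (orbit (T47 :: ('a, 4) struct)) \<le> enat 11"
    by (rule zariski_dim_le_if_param[OF polyfun_param orbit_T47_subset_closure_param[OF two]])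
  then show "zariski_dim (orbit (T47 :: ('a, 4) struct)) = 11"
    using zariski_dim_orbit_T47_ge[OF two] by (simp add: numeral_eq_enat)
qed

end
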